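(* Let $h>0$ be fixed and let $f:\mathbb{R}\to\mathbb{R}$ be a locally Lipschitz function with $f(0)=0$. Then the initial-value problem for $$\frac{d^{2}\mathbf{v}}{dt^{2}} =D^{+}D^{-}\big(\boldsymbol{\beta}_{h}\ast f(\mathbf{v})\big)$$ is locally well-posed for initial data $\mathbf{v}(0),\ \mathbf{v}^{\prime}(0)$ in $l^{\infty}$. Moreover, there exists some maximal time $T_{h}>0$ so that the problem has a unique solution $\mathbf{v}\in C^{2}([0,T_{h}),l^{\infty})$. The maximal time $T_{h}$, if finite, is determined by the blow-up condition $$\limsup_{t\rightarrow T_{h}^{-}}\Vert \mathbf{v}(t)\Vert_{l^{\infty} }=\infty .$$
   Context: Standing assumptions on the kernel: $\beta:\mathbb{R}\to\mathbb{R}$ is even with $\int_{\mathbb{R}}\beta(x)\,dx=1$, $\beta\in W^{1,1}(\mathbb{R})$ (identified with its continuous representative), and its second distributional derivative $\beta''=\mu$ is a finite Borel measure on $\mathbb{R}$. Sequences: $\mathbf{u}=(u_i)_{i\in\mathbb{Z}}$ denotes a two-sided infinite real sequence; $l^\infty=l^\infty(\mathbb{Z})$ with $\Vert\mathbf{u}\Vert_{l^\infty}=\sup_{i\in\mathbb{Z}}|u_i|$. The grid is $x_i=ih$, $i\in\mathbb{Z}$. The kernel restriction is $\boldsymbol{\beta}_h=(\beta(x_i))_{i\in\mathbb{Z}}$ and $f(\mathbf{v})=(f(v_i))_{i\in\mathbb{Z}}$. The discrete convolution is $(\mathbf{u}\ast\mathbf{v})_i=\sum_{j\in\mathbb{Z}}h\,u_{i-j}v_j$.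 The difference operators are $(D^+\mathbf{u})_i=\frac1h(u_{i+1}-u_i)$ and $(D^-\mathbf{u})_i=\frac1h(u_i-u_{i-1})$, so that $(D^+D^-\mathbf{u})_i=\frac1{h^2}(u_{i+1}-2u_i+u_{i-1})$. *)

theory Defs
  imports "HOL-Analysis.Analysis"
begin

section \<open>The kernel\<close>

definition test_function :: "(real \<Rightarrow> real) \<Rightarrow> bool" where
  "test_function \<phi> \<longleftrightarrow>
     (\<forall>n x. (deriv ^^ n) \<phi> differentiable (at x)) \<and> compact (closure {x. \<phi> x \<noteq> 0})"

definition weak_derivative :: "(real \<Rightarrow> real) \<Rightarrow> (real \<Rightarrow> real) \<Rightarrow> bool" where
  "weak_derivative u g \<longleftrightarrow>
     (\<forall>\<phi>. test_function \<phi> \<longrightarrow>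
        (\<integral>x. u x * deriv \<phi> x \<partial>lborel) = - (\<integral>x. g x * \<phi> x \<partial>lborel))"

definition sobolev_W11 :: "(real \<Rightarrow> real) \<Rightarrow> bool" where
  "sobolev_W11 u \<longleftrightarrow>
     integrable lborel u \<and> (\<exists>g. integrable lborel g \<and> weak_derivative u g)"

text \<open>
  A finite real-valued Borel measure is represented by its Jordan decomposition
  \<open>\<mu> = M - N\<close> into finite nonnegative measures. It has to be allowed to change sign:
  an integrable \<open>u\<close> with \<open>u'' \<ge> 0\<close> is convex and hence zero, while for instance
  \<open>u x = exp (- \<bar>x\<bar>) / 2\<close> has \<open>u'' = u - \<delta>\<close>.
\<close>

definition second_derivative_finite_measure :: "(real \<Rightarrow> real) \<Rightarrow> bool" where
  "second_derivative_finite_measure u \<longleftrightarrow>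
     (\<exists>M N. finite_measure M \<and> sets M = sets borel \<and>
            finite_measure N \<and> sets N = sets borel \<and>
        (\<forall>\<phi>. test_function \<phi> \<longrightarrow>
           (\<integral>x. u x * (deriv ^^ 2) \<phi> x \<partial>lborel) = (\<integral>x. \<phi> x \<partial>M) - (\<integral>x. \<phi> x \<partial>N)))"

text \<open>Continuity selects the continuous representative of the class in \<open>W\<^sup>1\<^sup>,\<^sup>1\<close>.\<close>

definition admissible_kernel :: "(real \<Rightarrow> real) \<Rightarrow> bool" where
  "admissible_kernel \<beta> \<longleftrightarrow>
     (\<forall>x. \<beta> (- x) = \<beta> x) \<and>
     (\<integral>x. \<beta> x \<partial>lborel) = 1 \<and>
     sobolev_W11 \<beta> \<and> continuous_on UNIV \<beta> \<and>
     second_derivative_finite_measure \<beta>"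

definition locally_lipschitz :: "(real \<Rightarrow> real) \<Rightarrow> bool" where
  "locally_lipschitz f \<longleftrightarrow> (\<forall>x. \<exists>r>0. \<exists>L. L-lipschitz_on (ball x r) f)"

section \<open>Sequences and discrete operators\<close>

text \<open>
  \<open>int\<close> carries the discrete topology, so the bounded continuous functions on it are
  exactly the bounded two-sided sequences, with the supremum norm.
\<close>

type_synonym linf = "int \<Rightarrow>\<^sub>C real"

lemma bcontfun_linf_iff: "(u :: int \<Rightarrow> real) \<in> bcontfun \<longleftrightarrow> bounded (range u)"
  by (simp add: bcontfun_def)

lemma norm_linf: "norm (u :: linf) = (SUP i. \<bar>u i\<bar>)"
  by (simp add: norm_bcontfun_def dist_bcontfun.rep_eq zero_bcontfun.rep_eq)

definition diff_plus :: "real \<Rightarrow> (int \<Rightarrow> real) \<Rightarrow> int \<Rightarrow> real" where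
  "diff_plus h u i = (u (i + 1) - u i) / h"

definition diff_minus :: "real \<Rightarrow> (int \<Rightarrow> real) \<Rightarrow> int \<Rightarrow> real" where
  "diff_minus h u i = (u i - u (i - 1)) / h"

definition discrete_conv :: "real \<Rightarrow> (int \<Rightarrow> real) \<Rightarrow> (int \<Rightarrow> real) \<Rightarrow> int \<Rightarrow> real" where
  "discrete_conv h u v i = (\<Sum>\<^sub>\<infinity>j\<in>UNIV. h * u (i - j) * v j)"

definition grid_restriction :: "real \<Rightarrow> (real \<Rightarrow> real) \<Rightarrow> int \<Rightarrow> real" where
  "grid_restriction h \<beta> i = \<beta> (of_int i * h)"

definition semidiscrete_rhs ::
  "real \<Rightarrow> (real \<Rightarrow> real) \<Rightarrow> (real \<Rightarrow> real) \<Rightarrow> (int \<Rightarrow> real) \<Rightarrow> int \<Rightarrow> real" where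
  "semidiscrete_rhs h \<beta> f v =
     diff_plus h (diff_minus h (discrete_conv h (grid_restriction h \<beta>) (\<lambda>j. f (v j))))"

section \<open>The initial-value problem\<close>

text \<open>Derivatives are taken in the norm of \<open>l\<^sup>\<infinity>\<close> and are one-sided at end points of \<open>S\<close>.\<close>

definition C2_on ::
  "real set \<Rightarrow> (real \<Rightarrow> linf) \<Rightarrow> (real \<Rightarrow> linf) \<Rightarrow> (real \<Rightarrow> linf) \<Rightarrow> bool" where
  "C2_on S v v' v'' \<longleftrightarrow>
     (\<forall>t\<in>S. (v has_vector_derivative v' t) (at t within S)) \<and>
     (\<forall>t\<in>S. (v' has_vector_derivative v'' t) (at t within S)) \<and>
     continuous_on S v''"

text \<open>
  The time set \<open>S\<close> is meant to be a nondegenerate interval containing \<open>0\<close>; then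
  \<open>v'\<close> and \<open>v''\<close> are determined by \<open>v\<close> on \<open>S\<close>.
\<close>

definition ivp_solution_derivs ::
  "real \<Rightarrow> (real \<Rightarrow> real) \<Rightarrow> (real \<Rightarrow> real) \<Rightarrow> linf \<Rightarrow> linf \<Rightarrow> real set \<Rightarrow>
     (real \<Rightarrow> linf) \<Rightarrow> (real \<Rightarrow> linf) \<Rightarrow> (real \<Rightarrow> linf) \<Rightarrow> bool" where
  "ivp_solution_derivs h \<beta> f \<phi> \<psi> S v v' v'' \<longleftrightarrow>
     C2_on S v v' v'' \<and> v 0 = \<phi> \<and> v' 0 = \<psi> \<and>
     (\<forall>t\<in>S. \<forall>i. v'' t i = semidiscrete_rhs h \<beta> f (v t) i)"

definition ivp_solution ::
  "real \<Rightarrow> (real \<Rightarrow> real) \<Rightarrow> (real \<Rightarrow> real) \<Rightarrow> linf \<Rightarrow> linf \<Rightarrow> real set \<Rightarrow>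
     (real \<Rightarrow> linf) \<Rightarrow> bool" where
  "ivp_solution h \<beta> f \<phi> \<psi> S v \<longleftrightarrow> (\<exists>v' v''. ivp_solution_derivs h \<beta> f \<phi> \<psi> S v v' v'')"

text \<open>
  Local well-posedness in the sense of Hadamard: around every pair of data there are a
  ball of data and a common time interval \<open>[0, T]\<close> on which solutions exist, are unique,
  and depend continuously on the data as elements of \<open>C\<^sup>2([0, T], l\<^sup>\<infinity>)\<close>.
\<close>

definition locally_well_posed :: "real \<Rightarrow> (real \<Rightarrow> real) \<Rightarrow> (real \<Rightarrow> real) \<Rightarrow> bool" where
  "locally_well_posed h \<beta> f \<longleftrightarrow>
     (\<forall>p\<^sub>0 :: linf \<times> linf. \<exists>r>0. \<exists>T>0. \<exists>V V' V'' :: linf \<times> linf \<Rightarrow> real \<Rightarrow> linf.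
        \<forall>p\<in>ball p\<^sub>0 r.
          ivp_solution_derivs h \<beta> f (fst p) (snd p) {0..T} (V p) (V' p) (V'' p) \<and>
          (\<forall>w. ivp_solution h \<beta> f (fst p) (snd p) {0..T} w \<longrightarrow> (\<forall>t\<in>{0..T}. w t = V p t)) \<and>
          uniform_limit {0..T} V (V p) (at p within ball p\<^sub>0 r) \<and>
          uniform_limit {0..T} V' (V' p) (at p within ball p\<^sub>0 r) \<and>
          uniform_limit {0..T} V'' (V'' p) (at p within ball p\<^sub>0 r))"

text \<open>The interval \<open>[0, T)\<close>, where \<open>T = \<infinity>\<close> is allowed.\<close>

definition time_interval :: "ereal \<Rightarrow> real set" where
  "time_interval T = {t. 0 \<le> t \<and> ereal t < T}"

end

theory Submission
  imports Defs
begin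

text \<open>
  Testing the weak derivative of the kernel \<open>\<beta>\<close> against smooth approximations of indicator functions
  bounds the oscillation of \<open>\<beta>\<close> on each grid cell by the integral of \<open>\<bar>\<beta>'\<bar>\<close> over that cell; hence
  \<open>\<Sum>\<^sub>i h \<bar>\<beta> (i h)\<bar> \<le> \<integral> \<bar>\<beta>\<bar> + h \<integral> \<bar>\<beta>'\<bar>\<close>, and discrete convolution with the kernel is bounded
  on \<open>l\<^sup>\<infinity>\<close>. Cutting \<open>f\<close> off outside \<open>[-R, R]\<close> makes the equation a first-order system with globally
  Lipschitz right-hand side on \<open>l\<^sup>\<infinity> \<times> l\<^sup>\<infinity>\<close>, whose flow comes at once for all times from a single
  contraction in an exponentially weighted supremum norm. This flow solves the original problem exactly
  as long as its first component stays in the ball of radius \<open>R\<close>. The flows for different \<open>R\<close> agree where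
  both do so, and gluing them yields the maximal solution, which can therefore stop at a finite time only
  by leaving every ball.
\<close>

section \<open>Smooth step functions\<close>

text \<open>Infinite differentiability in coinductive form: membership in some set of functions
  closed under differentiation. Closure properties are then proved by exhibiting such a set, without
  formulas for iterated derivatives.\<close>

definition smooth :: "(real \<Rightarrow> real) \<Rightarrow> bool" where
  "smooth \<phi> \<longleftrightarrow>
     (\<exists>S. \<phi> \<in> S \<and> (\<forall>g\<in>S. \<exists>g'\<in>S. \<forall>x. (g has_real_derivative g' x) (at x)))"

lemma smoothI:
  assumes "\<phi> \<in> S" "\<And>g. g \<in> S \<Longrightarrow> \<exists>g'\<in>S. \<forall>x. (g has_real_derivative g' x) (at x)"
  shows "smooth \<phi>"
  using assms unfolding smooth_def by blast

lemma smoothE: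
  assumes "smooth \<phi>"
  obtains \<phi>' where "smooth \<phi>'" "\<And>x. (\<phi> has_real_derivative \<phi>' x) (at x)"
  using assms unfolding smooth_def by blast

lemma smooth_antiderivative:
  assumes "smooth \<phi>'" "\<And>x. (\<phi> has_real_derivative \<phi>' x) (at x)"
  shows "smooth \<phi>"
  by (rule smoothI[of _ "insert \<phi> (Collect smooth)"]) (use assms smoothE in blast)+

lemma deriv_eqI: "(\<And>x. (\<phi> has_real_derivative \<phi>' x) (at x)) \<Longrightarrow> deriv \<phi> = \<phi>'"
  by (rule ext) (rule DERIV_imp_deriv)

lemma smooth_deriv_iterate: "smooth \<phi> \<Longrightarrow> smooth ((deriv ^^ n) \<phi>)"
proof (induction n)
  case (Suc n)
  then have "smooth ((deriv ^^ n) \<phi>)" by simp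
  then obtain \<phi>' where "smooth \<phi>'" "\<And>x. ((deriv ^^ n) \<phi> has_real_derivative \<phi>' x) (at x)"
    by (rule smoothE) blast
  then show ?case using deriv_eqI[of "(deriv ^^ n) \<phi>" \<phi>'] by simp
qed simp

lemma smooth_imp_differentiable: "smooth \<phi> \<Longrightarrow> \<phi> differentiable (at x)"
  by (metis smoothE real_differentiable_def)

lemma smooth_imp_continuous_on: "smooth \<phi> \<Longrightarrow> continuous_on S \<phi>"
  by (intro continuous_at_imp_continuous_on ballI differentiable_imp_continuous_within
      smooth_imp_differentiable)

lemma test_function_smoothI:
  "smooth \<phi> \<Longrightarrow> compact (closure {x. \<phi> x \<noteq> 0}) \<Longrightarrow> test_function \<phi>"
  unfolding test_function_def by (auto intro: smooth_imp_differentiable smooth_deriv_iterate)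

section \<open>Closure properties of smooth functions\<close>

lemma smooth_diff:
  assumes "smooth \<phi>" "smooth \<psi>"
  shows "smooth (\<lambda>x. \<phi> x - \<psi> x)"
proof (rule smoothI[of _ "{\<lambda>x. g x - k x |g k. smooth g \<and> smooth k}"])
  fix g assume "g \<in> {\<lambda>x. g x - k x |g k. smooth g \<and> smooth k}"
  then obtain a b where g: "g = (\<lambda>x. a x - b x)" "smooth a" "smooth b" by blast
  obtain a' where "smooth a'" "\<And>x. (a has_real_derivative a' x) (at x)"
    using smoothE[OF g(2)] by blast
  moreover obtain b' where "smooth b'" "\<And>x. (b has_real_derivative b' x) (at x)"
    using smoothE[OF g(3)] by blast
  ultimately show "\<exists>g'\<in>{\<lambda>x. g x - k x |g k. smooth g \<and> smooth k}.
      \<forall>x. (g has_real_derivative g' x) (at x)"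
    unfolding g(1) by (intro bexI[of _ "\<lambda>x. a' x - b' x"]) (auto intro!: derivative_intros)
qed (use assms in blast)

lemma smooth_affine:
  assumes "smooth \<phi>"
  shows "smooth (\<lambda>x. \<phi> (m * x + b))"
\<comment> \<open>The factor \<open>c\<close> absorbs the powers of \<open>m\<close> that the chain
  rule produces.\<close>
proof (rule smoothI[of _ "{\<lambda>x. c * g (m * x + b) |c g. smooth g}"])
  show "(\<lambda>x. \<phi> (m * x + b)) \<in> {\<lambda>x. c * g (m * x + b) |c g. smooth g}"
    using assms by (auto intro!: exI[of _ 1])
  fix g assume "g \<in> {\<lambda>x. c * g (m * x + b) |c g. smooth g}"
  then obtain c a where g: "g = (\<lambda>x. c * a (m * x + b))" "smooth a" by blast
  obtain a' where a': "smooth a'" "\<And>x. (a has_real_derivative a' x) (at x)"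
    using smoothE[OF g(2)] by blast
  have "(g has_real_derivative c * m * a' (m * x + b)) (at x)" for x
    unfolding g(1) by (auto intro!: derivative_eq_intros DERIV_chain2[OF a'(2)])
  then show "\<exists>g'\<in>{\<lambda>x. c * g (m * x + b) |c g. smooth g}.
      \<forall>x. (g has_real_derivative g' x) (at x)"
    using a'(1) by (intro bexI[of _ "\<lambda>x. c * m * a' (m * x + b)"]) auto
qed

text \<open>By the product rule the derivative of a product is a sum of two products, so the
  products have to be closed under addition to form a set that is stable under
  differentiation.\<close>

inductive_set sums_of_products :: "(real \<Rightarrow> real) set" where
  product: "smooth g \<Longrightarrow> smooth k \<Longrightarrow> (\<lambda>x. g x * k x) \<in> sums_of_products"
| add: "p \<in> sums_of_products \<Longrightarrow> q \<in> sums_of_products \<Longrightarrow> (\<lambda>x. p x + q x) \<in> sums_of_products"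

lemma smooth_mult:
  assumes "smooth \<phi>" "smooth \<psi>"
  shows "smooth (\<lambda>x. \<phi> x * \<psi> x)"
proof (rule smoothI[of _ sums_of_products])
  show "\<exists>g'\<in>sums_of_products. \<forall>x. (g has_real_derivative g' x) (at x)"
    if "g \<in> sums_of_products" for g
    using that
  proof induction
    case (product g k)
    obtain g' where "smooth g'" "\<And>x. (g has_real_derivative g' x) (at x)"
      using smoothE[OF product(1)] by blast
    moreover obtain k' where "smooth k'" "\<And>x. (k has_real_derivative k' x) (at x)"
      using smoothE[OF product(2)] by blast
    ultimately show ?case
      using product
      by (intro bexI[of _ "\<lambda>x. g' x * k x + k' x * g x"])
         (auto intro!: derivative_intros sums_of_products.intros DERIV_mult)
  next
    case (add p q)
    then obtain p' q' where "p' \<in> sums_of_products" "q' \<in> sums_of_products"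
      "\<And>x. (p has_real_derivative p' x) (at x)" "\<And>x. (q has_real_derivative q' x) (at x)"
      by blast
    then show ?case
      by (intro bexI[of _ "\<lambda>x. p' x + q' x"]) (auto intro!: derivative_intros sums_of_products.intros)
  qed
qed (use assms in \<open>auto intro: product\<close>)

text \<open>For \<open>p = 1\<close> this is the classical smooth function that vanishes to infinite
  order at \<open>0\<close>. The polynomial in \<open>1 / x\<close> makes the family stable under
  differentiation.\<close>

definition flat :: "real poly \<Rightarrow> real \<Rightarrow> real" where
  "flat p x = (if x > 0 then poly p (inverse x) * exp (- inverse x) else 0)"

lemma poly_times_exp_tendsto_0: "((\<lambda>y::real. poly p y * exp (- y)) \<longlongrightarrow> 0) at_top"
proof -
  have "((\<lambda>y. \<Sum>i\<le>degree p. coeff p i * (y ^ i / exp y)) \<longlongrightarrow> (\<Sum>i\<le>degree p. coeff p i * 0)) at_top"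
    by (intro tendsto_intros tendsto_power_div_exp_0)
  then show ?thesis
    by (simp add: poly_altdef sum_distrib_left exp_minus divide_inverse mult_ac)
qed

text \<open>Away from \<open>0\<close> this is the chain rule with
  \<open>(1 / x)' = - (1 / x)^2\<close>. At \<open>0\<close> the difference quotient from the right
  is again a polynomial in \<open>1 / y\<close> times \<open>exp (- 1 / y)\<close>, and the
  exponential wins.\<close>

lemma flat_has_derivative:
  "(flat p has_real_derivative flat ([:0, 0, 1:] * (p - pderiv p)) x) (at x)"
proof -
  consider "x > 0" | "x < 0" | "x = 0" by linarith
  then show ?thesis
  proof cases
    case 1
    have "((\<lambda>x. poly p (inverse x) * exp (- inverse x)) has_real_derivative
        flat ([:0, 0, 1:] * (p - pderiv p)) x) (at x)"
      using 1 by (auto intro!: derivative_eq_intros DERIV_chain2[OF poly_DERIV]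
          simp: flat_def field_simps power2_eq_square)
    moreover have "eventually (\<lambda>y. flat p y = poly p (inverse y) * exp (- inverse y)) (nhds x)"
      using eventually_nhds_in_open[of "{0<..}" x] 1 by (auto elim!: eventually_mono simp: flat_def)
    ultimately show ?thesis
      by (subst DERIV_cong_ev[OF refl _ refl])
  next
    case 2
    have "((\<lambda>x. 0) has_real_derivative flat ([:0, 0, 1:] * (p - pderiv p)) x) (at x)"
      using 2 by (simp add: flat_def)
    moreover have "eventually (\<lambda>y. flat p y = 0) (nhds x)"
      using eventually_nhds_in_open[of "{..<0}" x] 2 by (auto elim!: eventually_mono simp: flat_def)
    ultimately show ?thesis
      by (subst DERIV_cong_ev[OF refl _ refl])
  next
    case 3
    have "((\<lambda>y. flat p y / y) \<longlongrightarrow> 0) (at_right 0)"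
    proof -
      have "((\<lambda>y. poly ([:0, 1:] * p) (inverse y) * exp (- inverse y)) \<longlongrightarrow> 0) (at_right 0)"
        by (rule filterlim_compose[OF poly_times_exp_tendsto_0 filterlim_inverse_at_top_right])
      then show ?thesis
        by (rule Lim_transform_eventually)
           (auto simp: eventually_at_filter flat_def field_simps)
    qed
    moreover have "((\<lambda>y. flat p y / y) \<longlongrightarrow> 0) (at_left 0)"
      by (rule Lim_transform_eventually[OF tendsto_const])
         (auto simp: eventually_at_filter flat_def)
    ultimately have "((\<lambda>y. flat p y / y) \<longlongrightarrow> 0) (at 0)"
      by (simp add: filterlim_at_split)
    then show ?thesis
      using 3 by (simp add: has_field_derivative_iff flat_def)
  qed
qed

lemma smooth_flat: "smooth (flat p)"
  by (rule smoothI[of _ "range flat"]) (auto intro: flat_has_derivative)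

text \<open>The derivative \<open>\<rho>\<close> is the bump
  \<open>flat 1 x * flat 1 (1 - x)\<close> and \<open>R\<close> is its primitive. The height
  \<open>c\<close> of the step is left unnormalised; positivity is all that is used of it.\<close>

lemma smooth_step_exists:
  obtains R \<rho> :: "real \<Rightarrow> real" and c :: real
  where "smooth R" "\<And>x. (R has_real_derivative \<rho> x) (at x)" "c > 0"
    "\<And>x. 0 \<le> \<rho> x" "\<And>x. x \<notin> {0..1} \<Longrightarrow> \<rho> x = 0"
    "\<And>x. x \<le> 0 \<Longrightarrow> R x = 0" "\<And>x. 1 \<le> x \<Longrightarrow> R x = c"
    "continuous_on UNIV \<rho>"
proof -
  define \<rho> where "\<rho> x = flat 1 x * flat 1 (- 1 * x + 1)" for x
  have "smooth \<rho>" unfolding \<rho>_def [abs_def] by (intro smooth_mult smooth_affine smooth_flat)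
  then have cont: "continuous_on S \<rho>" for S
    by (rule smooth_imp_continuous_on)
  have nonneg: "0 \<le> \<rho> x" for x by (simp add: \<rho>_def flat_def)
  have outside: "\<rho> x = 0" if "x \<notin> {0<..<1}" for x using that by (auto simp: \<rho>_def flat_def)
  \<comment> \<open>The bump vanishes on \<open>[-1, 0]\<close>; starting at \<open>-1\<close> makes
    every \<open>x \<ge> 0\<close> an interior point of \<open>{-1..x+1}\<close>, which yields a
    two-sided derivative.\<close>
  define R where "R x = integral {-1..x} \<rho>" for x
  have R0: "R x = 0" if "x \<le> 0" for x
  proof -
    have "integral {-1..x} \<rho> = integral {-1..x} (\<lambda>_. 0)"
      using that by (intro integral_cong outside) auto
    then show ?thesis by (simp add: R_def)
  qed
  have R1: "R x = integral {0..1} \<rho>" if "1 \<le> x" for x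
  proof -
    have "(\<rho> has_integral integral {0..1} \<rho>) {-1..x}"
      using that
      by (intro has_integral_on_superset[OF integrable_integral outside] integrable_continuous_real cont)
         auto
    then have "integral {-1..x} \<rho> = integral {0..1} \<rho>" by (rule integral_unique)
    then show ?thesis by (simp add: R_def)
  qed
  have deriv: "(R has_real_derivative \<rho> x) (at x)" for x
  proof (cases "x < 0")
    case True
    have "eventually (\<lambda>y. R y = 0) (nhds x)"
      using eventually_nhds_in_open[of "{..<0}" x] True by (auto elim!: eventually_mono simp: R0)
    then have "(R has_real_derivative 0) (at x) \<longleftrightarrow> ((\<lambda>_. 0::real) has_real_derivative 0) (at x)"
      by (intro DERIV_cong_ev) auto
    then show ?thesis using outside[of x] True by simp
  next
    case False
    have "(R has_vector_derivative \<rho> x) (at x within {-1..x+1})"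
      unfolding R_def using False by (intro integral_has_vector_derivative cont) auto
    moreover have "at x within {-1..x+1} = at x"
      using False by (intro at_within_interior) auto
    ultimately show ?thesis by (simp add: has_real_derivative_iff_has_vector_derivative)
  qed
  have "integral {0..1} \<rho> \<noteq> 0"
  proof
    assume "integral {0..1} \<rho> = 0"
    then have "\<rho> (1/2) = 0"
      using integral_eq_0_iff[of 0 1 \<rho>] cont nonneg by auto
    then show False by (simp add: \<rho>_def flat_def)
  qed
  moreover have "0 \<le> integral {0..1} \<rho>"
    by (intro Henstock_Kurzweil_Integration.integral_nonneg integrable_continuous_real cont nonneg)
  ultimately have pos: "integral {0..1} \<rho> > 0" by simp
  show thesis
  proof
    show "smooth R" using \<open>smooth \<rho>\<close> deriv by (rule smooth_antiderivative)
    show "x \<notin> {0..1} \<Longrightarrow> \<rho> x = 0" for x by (rule outside) auto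
  qed (rule deriv pos nonneg R0 R1 cont | assumption)+
qed

section \<open>Summability of the grid restriction of the kernel\<close>

text \<open>The rescaled bump \<open>k\<close> has mass \<open>c\<close> and lives on
  \<open>[a, a + \<epsilon>]\<close>, where \<open>u\<close> differs from \<open>u a\<close> by at
  most \<open>\<delta>\<close>. Hence the integral is \<open>c\<close> times a weighted mean of such
  values.\<close>

lemma mollified_value_approx:
  fixes u \<rho> R :: "real \<Rightarrow> real"
  assumes R: "\<And>x. (R has_real_derivative \<rho> x) (at x)" and c: "c > 0" and nonneg: "\<And>x. 0 \<le> \<rho> x"
    and outside: "\<And>x. x \<notin> {0..1} \<Longrightarrow> \<rho> x = 0" and R0: "R 0 = 0" and R1: "R 1 = c"
    and cont_\<rho>: "continuous_on UNIV \<rho>" and cont_u: "continuous_on UNIV u" and "0 < \<epsilon>"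
    and near: "\<And>x. x \<in> {a..a+\<epsilon>} \<Longrightarrow> \<bar>u x - u a\<bar> \<le> \<delta>"
  defines "k \<equiv> \<lambda>x. \<rho> ((x - a) / \<epsilon>) / \<epsilon>"
  shows "integrable lborel (\<lambda>x. u x * k x)"
    and "\<bar>(\<integral>x. u x * k x \<partial>lborel) - c * u a\<bar> \<le> \<delta> * c"
proof -
  have k_eq: "f x * k x = f x * k x * indicator {a..a+\<epsilon>} x" for x and f :: "real \<Rightarrow> real"
    using outside[of "(x - a) / \<epsilon>"] \<open>0 < \<epsilon>\<close> by (auto simp: indicator_def k_def field_simps)
  have k_ind: "(\<lambda>x. k x * indicator {a..a+\<epsilon>} x) = k"
    by (rule ext) (use k_eq[of "\<lambda>_. 1"] in simp)
  have cont_k: "continuous_on UNIV k"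
    unfolding k_def using \<open>0 < \<epsilon>\<close> by (intro continuous_intros continuous_on_compose2[OF cont_\<rho>]) auto
  have int: "integrable lborel (\<lambda>x. f x * k x)" if "continuous_on UNIV f" for f :: "real \<Rightarrow> real"
  proof -
    have "set_integrable lborel {a..a+\<epsilon>} (\<lambda>x. f x * k x)"
      by (intro borel_integrable_atLeastAtMost' continuous_on_mult continuous_on_subset[OF that]
          continuous_on_subset[OF cont_k]) auto
    then show ?thesis
      unfolding set_integrable_def by (subst k_eq) (simp add: mult_ac)
  qed
  show uk: "integrable lborel (\<lambda>x. u x * k x)" by (rule int[OF cont_u])
  have "(\<integral>x. k x * indicator {a..a+\<epsilon>} x \<partial>lborel) = R ((a + \<epsilon> - a) / \<epsilon>) - R ((a - a) / \<epsilon>)"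
  proof (rule integral_FTC_Icc_real)
    show "((\<lambda>x. R ((x - a) / \<epsilon>)) has_real_derivative k x) (at x)" for x
    proof -
      have "((\<lambda>x. R ((x - a) / \<epsilon>)) has_real_derivative \<rho> ((x - a) / \<epsilon>) * (1 / \<epsilon>)) (at x)"
        by (rule DERIV_chain2[OF R]) (use \<open>0 < \<epsilon>\<close> in \<open>auto intro!: derivative_eq_intros\<close>)
      then show ?thesis by (simp add: k_def)
    qed
    show "isCont k x" for x
      using cont_k by (simp add: continuous_on_eq_continuous_at)
  qed (use \<open>0 < \<epsilon>\<close> in auto)
  then have c_eq: "(\<integral>x. k x \<partial>lborel) = c"
    using \<open>0 < \<epsilon>\<close> R0 R1 by (simp add: k_ind)
  have k_int: "integrable lborel k" using int[of "\<lambda>_. 1"] by simp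
  have "(\<integral>x. u x * k x \<partial>lborel) - c * u a = (\<integral>x. (u x - u a) * k x \<partial>lborel)"
  proof -
    have "(\<integral>x. (u x - u a) * k x \<partial>lborel) = (\<integral>x. u x * k x \<partial>lborel) - (\<integral>x. u a * k x \<partial>lborel)"
      unfolding left_diff_distrib using uk k_int by (intro Bochner_Integration.integral_diff) auto
    then show ?thesis by (simp add: c_eq)
  qed
  also have "norm \<dots> \<le> (\<integral>x. \<delta> * k x \<partial>lborel)"
  proof (rule Bochner_Integration.integral_norm_bound_integral)
    show "integrable lborel (\<lambda>x. (u x - u a) * k x)"
      by (intro int continuous_intros cont_u)
    show "norm ((u x - u a) * k x) \<le> \<delta> * k x" for x
    proof (cases "x \<in> {a..a+\<epsilon>}")
      case True
      have "0 \<le> k x" using nonneg \<open>0 < \<epsilon>\<close> by (simp add: k_def)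
      then show ?thesis using near[OF True] by (simp add: abs_mult mult_right_mono)
    next
      case False
      then have "k x = 0" using k_eq[of "\<lambda>_. 1" x] by simp
      then show ?thesis by simp
    qed
  qed (use k_int in auto)
  finally show "\<bar>(\<integral>x. u x * k x \<partial>lborel) - c * u a\<bar> \<le> \<delta> * c" using c_eq by simp
qed

text \<open>The test function is a difference of two smooth steps, at \<open>a\<close> and at
  \<open>b\<close>, that is, a smoothed \<open>c\<close> times the indicator of
  \<open>[a, b]\<close>. Its derivative has two bumps, which recover \<open>c * (u a - u b)\<close>
  up to a small error. The step at \<open>b\<close> needs room to its right, hence the point
  \<open>d\<close>.\<close>

lemma weak_derivative_diff_le:
  assumes g: "integrable lborel g" and weak: "weak_derivative u g"
    and cont: "continuous_on UNIV u" and ab: "a < b" "b < d"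
  shows "\<bar>u a - u b\<bar> \<le> (\<integral>x. indicator {a<..<d} x * \<bar>g x\<bar> \<partial>lborel)" (is "_ \<le> ?I")
proof (rule field_le_epsilon)
  fix e :: real assume "0 < e"
  \<comment> \<open>Two approximation errors occur, one at \<open>a\<close> and one at
    \<open>b\<close>.\<close>
  define \<delta> where "\<delta> = e / 2"
  then have "0 < \<delta>" using \<open>0 < e\<close> by simp
  obtain R \<rho> and c :: real where R: "smooth R" "\<And>x. (R has_real_derivative \<rho> x) (at x)" "c > 0"
    and \<rho>: "\<And>x. 0 \<le> \<rho> x" "\<And>x. x \<notin> {0..1} \<Longrightarrow> \<rho> x = 0"
    and R01: "\<And>x. x \<le> 0 \<Longrightarrow> R x = 0" "\<And>x. 1 \<le> x \<Longrightarrow> R x = c" and "continuous_on UNIV \<rho>"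
    using smooth_step_exists by blast
  have mono: "R x \<le> R y" if "x \<le> y" for x y
    using DERIV_nonneg_imp_nondecreasing[OF that, of R] R(2) \<rho>(1) by blast
  have R_bounds: "0 \<le> R x" "R x \<le> c" for x
    using mono[of "min x 0" x] mono[of x "max x 1"] R01(1)[of "min x 0"] R01(2)[of "max x 1"] by auto
  obtain \<epsilon> where \<epsilon>: "0 < \<epsilon>" "\<epsilon> \<le> d - b"
    and near_a: "\<And>x. x \<in> {a..a+\<epsilon>} \<Longrightarrow> \<bar>u x - u a\<bar> \<le> \<delta>"
    and near_b: "\<And>x. x \<in> {b..b+\<epsilon>} \<Longrightarrow> \<bar>u x - u b\<bar> \<le> \<delta>"
  proof -
    have *: "\<exists>r>0. \<forall>x. \<bar>x - z\<bar> < r \<longrightarrow> \<bar>u x - u z\<bar> < \<delta>" for z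
      using cont \<open>0 < \<delta>\<close> unfolding continuous_on_iff by (auto simp: dist_real_def)
    obtain r s where "0 < r" "\<And>x. \<bar>x - a\<bar> < r \<Longrightarrow> \<bar>u x - u a\<bar> < \<delta>"
      "0 < s" "\<And>x. \<bar>x - b\<bar> < s \<Longrightarrow> \<bar>u x - u b\<bar> < \<delta>"
      using *[of a] *[of b] by blast
    then show thesis
      \<comment> \<open>Halving the radius keeps the closed intervals inside the open
        neighbourhoods; the bound \<open>d - b\<close> keeps the step at \<open>b\<close> to the
        left of \<open>d\<close>.\<close>
      using ab by (intro that[of "min (min r s / 2) (d - b)"]) (auto intro!: less_imp_le)
  qed
  define k where "k z x = \<rho> ((x - z) / \<epsilon>) / \<epsilon>" for z x
  define \<phi> where "\<phi> x = R (1 / \<epsilon> * x + (- a / \<epsilon>)) - R (1 / \<epsilon> * x + (- b / \<epsilon>))" for x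
  have \<phi>_eq: "\<phi> x = R ((x - a) / \<epsilon>) - R ((x - b) / \<epsilon>)" for x
    by (simp add: \<phi>_def diff_divide_distrib)
  have \<phi>_le: "\<bar>\<phi> x\<bar> \<le> c" for x
    using R_bounds[of "(x - a) / \<epsilon>"] R_bounds[of "(x - b) / \<epsilon>"] by (simp add: \<phi>_eq)
  \<comment> \<open>To the left of \<open>a\<close> both steps are still \<open>0\<close>, to the
    right of \<open>d\<close> both have reached \<open>c\<close>.\<close>
  have \<phi>_0: "\<phi> x = 0" if "x \<notin> {a<..<d}" for x
  proof (cases "x \<le> a")
    case True
    then show ?thesis using ab \<epsilon> by (simp add: \<phi>_eq R01 divide_nonpos_pos)
  next
    case False
    then have "b + \<epsilon> \<le> x" using that ab \<epsilon> by auto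
    then have "1 \<le> (x - a) / \<epsilon>" "1 \<le> (x - b) / \<epsilon>" using ab \<epsilon> by (auto simp: field_simps)
    then show ?thesis by (simp add: \<phi>_eq R01)
  qed
  have smooth: "smooth \<phi>"
    unfolding \<phi>_def [abs_def] by (intro smooth_diff smooth_affine R)
  have "{x. \<phi> x \<noteq> 0} \<subseteq> {a..d}"
  proof
    fix x assume "x \<in> {x. \<phi> x \<noteq> 0}"
    then have "x \<in> {a<..<d}" using \<phi>_0[of x] by blast
    then show "x \<in> {a..d}" by simp
  qed
  then have "bounded {x. \<phi> x \<noteq> 0}" using bounded_closed_interval bounded_subset by blast
  then have test: "test_function \<phi>" by (intro test_function_smoothI smooth) simp
  have "((\<lambda>x. R ((x - z) / \<epsilon>)) has_real_derivative k z x) (at x)" for x z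
  proof -
    have "((\<lambda>x. R ((x - z) / \<epsilon>)) has_real_derivative \<rho> ((x - z) / \<epsilon>) * (1 / \<epsilon>)) (at x)"
      by (rule DERIV_chain2[OF R(2)]) (use \<epsilon> in \<open>auto intro!: derivative_eq_intros\<close>)
    then show ?thesis by (simp add: k_def)
  qed
  then have deriv_\<phi>: "deriv \<phi> = (\<lambda>x. k a x - k b x)"
    by (intro deriv_eqI) (auto intro!: DERIV_diff simp: \<phi>_eq [abs_def])
  have "(\<integral>x. u x * deriv \<phi> x \<partial>lborel) = - (\<integral>x. g x * \<phi> x \<partial>lborel)"
    using weak test unfolding weak_derivative_def by blast
  then have weak_eq: "(\<integral>x. u x * k a x - u x * k b x \<partial>lborel) = - (\<integral>x. g x * \<phi> x \<partial>lborel)"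
    unfolding deriv_\<phi> right_diff_distrib .
  have bound: "\<bar>\<integral>x. g x * \<phi> x \<partial>lborel\<bar> \<le> c * ?I"
  proof -
    have int: "integrable lborel (\<lambda>x. indicator {a<..<d} x * \<bar>g x\<bar>)"
      using integrable_mult_indicator[of "{a<..<d}" lborel "\<lambda>x. \<bar>g x\<bar>"] g by simp
    have "norm (\<integral>x. g x * \<phi> x \<partial>lborel) \<le> (\<integral>x. c * (indicator {a<..<d} x * \<bar>g x\<bar>) \<partial>lborel)"
    proof (rule Bochner_Integration.integral_norm_bound_integral)
      have meas: "\<phi> \<in> borel_measurable lborel"
        using borel_measurable_continuous_onI[OF smooth_imp_continuous_on[OF smooth]] by simp
      have "integrable lborel (\<lambda>x. c * g x)" using g by simp
      then show "integrable lborel (\<lambda>x. g x * \<phi> x)"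
        by (rule Bochner_Integration.integrable_bound)
           (use meas g R(3) in \<open>auto simp: abs_mult mult.commute[of c] intro!: mult_left_mono \<phi>_le\<close>)
      show "norm (g x * \<phi> x) \<le> c * (indicator {a<..<d} x * \<bar>g x\<bar>)" for x
        using \<phi>_0[of x] \<phi>_le[of x]
        by (auto simp: indicator_def abs_mult mult.commute intro!: mult_right_mono)
    qed (use int in simp)
    then show ?thesis by simp
  qed
  have approx: "integrable lborel (\<lambda>x. u x * k z x)"
    "\<bar>(\<integral>x. u x * k z x \<partial>lborel) - c * u z\<bar> \<le> \<delta> * c"
    if "\<And>x. x \<in> {z..z+\<epsilon>} \<Longrightarrow> \<bar>u x - u z\<bar> \<le> \<delta>" for z
    unfolding k_def
    by (rule mollified_value_approx[where R = R]; fact R \<rho> \<epsilon> cont that R01(1)[OF order_refl]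
        R01(2)[OF order_refl] \<open>continuous_on UNIV \<rho>\<close>)+
  note approx_a = approx[of a, OF near_a, simplified] and approx_b = approx[of b, OF near_b, simplified]
  have "(\<integral>x. u x * k a x - u x * k b x \<partial>lborel)
      = (\<integral>x. u x * k a x \<partial>lborel) - (\<integral>x. u x * k b x \<partial>lborel)"
    using approx_a(1) approx_b(1) by simp
  then have "\<bar>c * u a - c * u b\<bar> \<le> c * ?I + 2 * (\<delta> * c)"
    using weak_eq bound approx_a(2) approx_b(2) by linarith
  moreover have "c * \<bar>u a - u b\<bar> = \<bar>c * u a - c * u b\<bar>"
    using \<open>c > 0\<close> by (simp add: abs_mult flip: right_diff_distrib)
  moreover have "c * ?I + 2 * (\<delta> * c) = c * (?I + e)"
    by (simp add: \<delta>_def distrib_left)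
  ultimately have "c * \<bar>u a - u b\<bar> \<le> c * (?I + e)" by linarith
  then show "\<bar>u a - u b\<bar> \<le> ?I + e" using \<open>c > 0\<close> by simp
qed

lemma sobolev_W11_grid_summable:
  assumes "sobolev_W11 u" and cont: "continuous_on UNIV u" and "0 < h"
  shows "(\<lambda>i. norm (grid_restriction h u i)) summable_on UNIV"
proof -
  obtain g where u: "integrable lborel u" and g: "integrable lborel g" and weak: "weak_derivative u g"
    using assms unfolding sobolev_W11_def by blast
  \<comment> \<open>The cells are open because \<open>weak_derivative_diff_le\<close> requires
    points strictly between the ends of the cell.\<close>
  define A where "A i = {real_of_int i * h<..<real_of_int i * h + h}" for i
  define W where "W x = \<bar>u x\<bar> + h * \<bar>g x\<bar>" for x
  have W: "integrable lborel W" unfolding W_def [abs_def] using u g by simp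
  have W0: "0 \<le> W x" for x using \<open>0 < h\<close> by (simp add: W_def)
  have ind: "integrable lborel (\<lambda>x. indicator (A i) x * f x)"
    if "integrable lborel f" for i and f :: "real \<Rightarrow> real"
    using integrable_mult_indicator[OF _ that, of "A i"] by (simp add: A_def)
  have disj: "disjoint_family_on A F" for F
    unfolding disjoint_family_on_def
  proof (intro ballI impI)
    fix i j :: int assume "i \<noteq> j"
    have *: "A i \<inter> A j = {}" if "i < j" for i j
    proof -
      have "real_of_int (i + 1) * h \<le> real_of_int j * h"
        using that \<open>0 < h\<close> by (intro mult_right_mono) linarith+
      then show ?thesis by (auto simp: A_def algebra_simps)
    qed
    show "A i \<inter> A j = {}"
      using *[of i j] *[of j i] \<open>i \<noteq> j\<close> by (metis Int_commute linorder_neq_iff)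
  qed
  \<comment> \<open>For \<open>x\<close> in the cell, \<open>|u (i h)| \<le> |u x| + ?G\<close>.
    Integration over \<open>x\<close> in the cell multiplies the two constants by its length
    \<open>h\<close>.\<close>
  have cell: "h * \<bar>u (of_int i * h)\<bar> \<le> (\<integral>x. indicator (A i) x * W x \<partial>lborel)" for i
  proof -
    let ?G = "\<integral>x. indicator (A i) x * \<bar>g x\<bar> \<partial>lborel"
    have "integrable lborel (indicator (A i) :: real \<Rightarrow> real)"
      using \<open>0 < h\<close> by (intro integrable_real_indicator) (auto simp: A_def)
    then have iI: "integrable lborel (\<lambda>x. indicator (A i) x * K)" for K :: real
      by simp
    have m: "(\<integral>x. indicator (A i) x * K \<partial>lborel) = h * K" for K :: real
      using \<open>0 < h\<close> by (simp add: A_def)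
    have "h * \<bar>u (of_int i * h)\<bar> = (\<integral>x. indicator (A i) x * \<bar>u (of_int i * h)\<bar> \<partial>lborel)"
      by (simp only: m)
    also have "\<dots> \<le> (\<integral>x. indicator (A i) x * \<bar>u x\<bar> + indicator (A i) x * ?G \<partial>lborel)"
    proof (rule integral_mono)
      fix x
      have "\<bar>u (of_int i * h)\<bar> \<le> \<bar>u x\<bar> + ?G" if "x \<in> A i"
        using weak_derivative_diff_le[OF g weak cont, of "of_int i * h" x "of_int i * h + h"] that
        unfolding A_def by simp
      then show "indicator (A i) x * \<bar>u (of_int i * h)\<bar> \<le>
          indicator (A i) x * \<bar>u x\<bar> + indicator (A i) x * ?G"
        by (auto simp: indicator_def)
    qed (intro Bochner_Integration.integrable_add iI ind integrable_abs u)+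
    also have "\<dots> = (\<integral>x. indicator (A i) x * \<bar>u x\<bar> \<partial>lborel) + h * ?G"
      by (subst Bochner_Integration.integral_add) (simp_all only: iI ind integrable_abs u m)
    also have "\<dots> = (\<integral>x. indicator (A i) x * \<bar>u x\<bar> + h * (indicator (A i) x * \<bar>g x\<bar>) \<partial>lborel)"
      using ind[OF integrable_abs[OF u]] ind[OF integrable_abs[OF g]] by simp
    also have "\<dots> = (\<integral>x. indicator (A i) x * W x \<partial>lborel)"
      by (simp add: W_def algebra_simps)
    finally show ?thesis .
  qed
  \<comment> \<open>The terms are nonnegative, so a common bound on finite sums suffices. As the
    cells are disjoint, their integrals add up to at most the integral of \<open>W\<close> over the
    line.\<close>
  have "(\<Sum>i\<in>F. norm (grid_restriction h u i)) \<le> (\<integral>x. W x \<partial>lborel) / h" if "finite F" for F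
  proof -
    have ind_UN: "indicator (\<Union>i\<in>F. A i) x * W x = (\<Sum>i\<in>F. indicator (A i) x * W x)" for x
      unfolding indicator_UN_disjoint[OF that disj] by (rule sum_distrib_right)
    have "h * (\<Sum>i\<in>F. norm (grid_restriction h u i)) \<le> (\<Sum>i\<in>F. \<integral>x. indicator (A i) x * W x \<partial>lborel)"
      unfolding sum_distrib_left grid_restriction_def real_norm_def by (intro sum_mono cell)
    also have "\<dots> = (\<integral>x. indicator (\<Union>i\<in>F. A i) x * W x \<partial>lborel)"
      unfolding ind_UN by (rule Bochner_Integration.integral_sum[symmetric]) (rule ind[OF W])
    also have "\<dots> \<le> (\<integral>x. W x \<partial>lborel)"
    proof (rule integral_mono)
      show "integrable lborel (\<lambda>x. indicator (\<Union>i\<in>F. A i) x * W x)"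
        unfolding ind_UN by (intro Bochner_Integration.integrable_sum ind[OF W])
    qed (use W W0 in \<open>auto simp: indicator_def\<close>)
    finally show ?thesis using \<open>0 < h\<close> by (simp add: field_simps)
  qed
  then show ?thesis
    unfolding abs_summable_iff_bdd_above by (intro bdd_aboveI2) auto
qed

section \<open>Ordinary differential equations with a Lipschitz right-hand side\<close>

text \<open>Integration against the weight \<open>exp (k * s)\<close> gains the factor
  \<open>1 / k\<close>. This gain produces the contraction below and also drives the uniqueness
  proof.\<close>

lemma norm_integral_le_exp:
  fixes g :: "real \<Rightarrow> 'a::banach"
  assumes "0 < k" "0 \<le> t" "0 \<le> C" "continuous_on {0..t} g"
    and le: "\<And>s. s \<in> {0..t} \<Longrightarrow> norm (g s) \<le> C * exp (k * s)"
  shows "norm (integral {0..t} g) \<le> C / k * exp (k * t)"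
proof -
  have *: "((\<lambda>s. C * exp (k * s)) has_integral (C / k * exp (k * t) - C / k * exp (k * 0))) {0..t}"
    using \<open>0 < k\<close> \<open>0 \<le> t\<close>
    by (intro fundamental_theorem_of_calculus)
       (auto intro!: derivative_eq_intros simp flip: has_real_derivative_iff_has_vector_derivative)
  have "norm (integral {0..t} g) \<le> integral {0..t} (\<lambda>s. C * exp (k * s))"
    using assms * by (intro integral_norm_bound_integral integrable_continuous_real continuous_intros) auto
  also have "\<dots> = C / k * exp (k * t) - C / k"
    by (subst integral_unique[OF *]) simp
  also have "\<dots> \<le> C / k * exp (k * t)"
    using assms by simp
  finally show ?thesis .
qed

text \<open>
  In terms of \<open>y t = exp (- k t) x t\<close> the integral equation for \<open>x\<close> has contraction constant \<open>L / k\<close>.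
  Freezing negative times at \<open>0\<close> makes \<open>y\<close> a bounded continuous function on a whole type.
\<close>

definition picard :: "('a::banach \<Rightarrow> 'a) \<Rightarrow> real \<Rightarrow> 'a \<Rightarrow> (real \<Rightarrow> 'a) \<Rightarrow> real \<Rightarrow> 'a" where
  "picard F k p y t =
     exp (- k * max 0 t) *\<^sub>R (p + integral {0..max 0 t} (\<lambda>s. F (exp (k * s) *\<^sub>R y s)))"

text \<open>The integrands differ by at most \<open>L * M * exp (k * s)\<close>; the weight
  \<open>exp (- k * t)\<close> cancels the exponential that integration leaves. With
  \<open>p = q\<close> this is the contraction estimate, and with different \<open>p\<close>,
  \<open>q\<close> it gives the dependence on the initial value.\<close>

lemma picard_diff_le:
  fixes F :: "'a::banach \<Rightarrow> 'a"
  assumes L: "L-lipschitz_on UNIV F" and "0 < k" "0 \<le> M"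
    and y: "continuous_on UNIV y" and z: "continuous_on UNIV z"
    and le: "\<And>s. norm (y s - z s) \<le> M"
  shows "norm (picard F k p y t - picard F k q z t) \<le> norm (p - q) + L / k * M"
proof -
  define \<tau> where "\<tau> = max 0 t"
  have "0 \<le> \<tau>" by (simp add: \<tau>_def)
  have L0: "0 \<le> L" using L by (rule lipschitz_on_nonneg)
  have F: "continuous_on S F" for S
    using lipschitz_on_continuous_on[OF L] continuous_on_subset by blast
  let ?w = "\<lambda>y s. F (exp (k * s) *\<^sub>R y s)"
  have cw: "continuous_on S (?w y)" if "continuous_on UNIV y" for y S
    by (rule continuous_on_compose2[OF F[of UNIV]])
       (auto intro!: continuous_intros continuous_on_subset[OF that])
  have "norm (?w y s - ?w z s) \<le> (L * M) * exp (k * s)" for s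
  proof -
    have "norm (?w y s - ?w z s) \<le> L * norm (exp (k * s) *\<^sub>R y s - exp (k * s) *\<^sub>R z s)"
      using lipschitz_on_normD[OF L] by auto
    also have "\<dots> = L * (exp (k * s) * norm (y s - z s))"
      by (simp flip: scaleR_diff_right)
    also have "\<dots> \<le> L * (exp (k * s) * M)"
      using L0 le by (intro mult_left_mono) auto
    finally show ?thesis by (simp add: mult_ac)
  qed
  then have *: "norm (integral {0..\<tau>} (\<lambda>s. ?w y s - ?w z s)) \<le> L * M / k * exp (k * \<tau>)"
    using \<open>0 < k\<close> \<open>0 \<le> M\<close> L0 \<open>0 \<le> \<tau>\<close>
    by (intro norm_integral_le_exp continuous_on_diff cw y z) auto
  have "picard F k p y t - picard F k q z t =
      exp (- k * \<tau>) *\<^sub>R ((p - q) + integral {0..\<tau>} (\<lambda>s. ?w y s - ?w z s))"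
  proof -
    have "integral {0..\<tau>} (\<lambda>s. ?w y s - ?w z s) = integral {0..\<tau>} (?w y) - integral {0..\<tau>} (?w z)"
      by (intro Henstock_Kurzweil_Integration.integral_diff integrable_continuous_real cw y z)
    then show ?thesis
      unfolding picard_def \<tau>_def[symmetric]
      by (simp add: scaleR_add_right scaleR_diff_right)
  qed
  also have "norm \<dots> \<le> exp (- k * \<tau>) * (norm (p - q) + L * M / k * exp (k * \<tau>))"
    using * by (auto intro!: norm_triangle_le)
  also have "\<dots> = exp (- k * \<tau>) * norm (p - q) + L / k * M"
    by (simp add: algebra_simps flip: exp_add)
  also have "\<dots> \<le> 1 * norm (p - q) + L / k * M"
    using \<open>0 < k\<close> \<open>0 \<le> \<tau>\<close> by (intro add_right_mono mult_right_mono) auto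
  finally show ?thesis by simp
qed

lemma continuous_on_picard:
  fixes F :: "'a::banach \<Rightarrow> 'a"
  assumes F: "continuous_on UNIV F" and y: "continuous_on UNIV y"
  shows "continuous_on UNIV (picard F k p y)"
proof -
  let ?I = "\<lambda>t. integral {0..t} (\<lambda>s. F (exp (k * s) *\<^sub>R y s))"
  have cw: "continuous_on S (\<lambda>s. F (exp (k * s) *\<^sub>R y s))" for S
    by (rule continuous_on_compose2[OF F])
       (auto intro!: continuous_intros continuous_on_subset[OF y])
  have I: "continuous_on {0..} ?I"
    unfolding continuous_on_eq_continuous_within
  proof
    \<comment> \<open>Continuity of the indefinite integral is known on compact intervals, and
      \<open>{0..t+1}\<close> contains a neighbourhood of \<open>t\<close> relative to
      \<open>{0..}\<close>.\<close>
    fix t :: real assume t: "t \<in> {0..}"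
    have "continuous_on {0..t+1} ?I"
      by (intro indefinite_integral_continuous_1 integrable_continuous_real cw)
    then have "continuous (at t within {0..t+1}) ?I"
      using t by (auto simp: continuous_on_eq_continuous_within)
    moreover have "at t within {0..t+1} = at t within {0..}"
      using t by (intro at_within_nhd[of _ "{..<t+1}"]) auto
    ultimately show "continuous (at t within {0..}) ?I" by simp
  qed
  show ?thesis
    unfolding picard_def [abs_def]
    by (intro continuous_intros continuous_on_compose2[OF I]) auto
qed

text \<open>The image is compared with that of the zero function for the initial value
  \<open>0\<close>, which is \<open>\<tau> * exp (- k * \<tau>)\<close> times \<open>F 0\<close>
  with \<open>\<tau> = max 0 t\<close> and stays bounded because
  \<open>k * \<tau> \<le> exp (k * \<tau>)\<close>.\<close>

lemma picard_bcontfun: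
  fixes F :: "'a::banach \<Rightarrow> 'a"
  assumes L: "L-lipschitz_on UNIV F" and "0 < k" and y: "y \<in> bcontfun"
  shows "picard F k p y \<in> bcontfun"
proof -
  have cy: "continuous_on UNIV y" using y by (auto simp: bcontfun_def)
  obtain M where M: "\<And>s. norm (y s) \<le> M"
    using y by (auto simp: bcontfun_def bounded_iff)
  have "0 \<le> M" using M[of 0] norm_ge_zero order_trans by blast
  have "norm (picard F k p y t) \<le> norm p + L / k * M + norm (F 0) / k" for t
  proof -
    have "norm (picard F k p y t - picard F k 0 (\<lambda>_. 0) t) \<le> norm (p - 0) + L / k * M"
      using M by (intro picard_diff_le L cy \<open>0 < k\<close> \<open>0 \<le> M\<close>) auto
    moreover have "norm (picard F k 0 (\<lambda>_. 0) t) \<le> norm (F 0) / k"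
    proof -
      have "picard F k 0 (\<lambda>_. 0) t = (max 0 t * exp (- k * max 0 t)) *\<^sub>R F 0"
        by (simp add: picard_def)
      also have "norm \<dots> = max 0 t * exp (- k * max 0 t) * norm (F 0)"
        by simp
      also have "max 0 t * exp (- k * max 0 t) \<le> 1 / k"
      proof -
        have "k * max 0 t \<le> exp (k * max 0 t)"
          using exp_ge_add_one_self[of "k * max 0 t"] by linarith
        then show ?thesis using \<open>0 < k\<close> by (simp add: field_simps exp_minus)
      qed
      finally show ?thesis by (simp add: mult_right_mono)
    qed
    ultimately show ?thesis
      using norm_triangle_sub[of "picard F k p y t" "picard F k 0 (\<lambda>_. 0) t"] by simp
  qed
  then show ?thesis
    by (intro bcontfun_normI continuous_on_picard cy lipschitz_on_continuous_on[OF L])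
qed

lemma lipschitz_ode_flow:
  fixes F :: "'a::banach \<Rightarrow> 'a"
  assumes L: "L-lipschitz_on UNIV F"
  obtains X :: "'a \<Rightarrow> real \<Rightarrow> 'a"
  where "\<And>p. X p 0 = p"
    and "\<And>p t. 0 \<le> t \<Longrightarrow> (X p has_vector_derivative F (X p t)) (at t within {0..})"
    and "\<And>p q t. 0 \<le> t \<Longrightarrow> norm (X p t - X q t) \<le> 2 * exp ((2 * L + 1) * t) * norm (p - q)"
proof -
  \<comment> \<open>This makes \<open>L / k\<close> at most one half, and \<open>k\<close> positive
    even for \<open>L = 0\<close>.\<close>
  define k where "k = 2 * L + 1"
  have L0: "0 \<le> L" using L by (rule lipschitz_on_nonneg)
  then have k: "0 < k" and Lk: "L / k \<le> 1 / 2" by (auto simp: k_def field_simps)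
  have half: "L / k * M \<le> M / 2" if "0 \<le> M" for M
    using mult_right_mono[OF Lk that] by simp
  have *: "norm (picard F k p y t - picard F k q z t) \<le> norm (p - q) + norm (y - z) / 2"
    for p q t and y z :: "real \<Rightarrow>\<^sub>C 'a"
  proof -
    have "norm (y s - z s) \<le> norm (y - z)" for s
      using norm_bounded[of "y - z" s] by simp
    then have "norm (picard F k p y t - picard F k q z t) \<le> norm (p - q) + L / k * norm (y - z)"
      by (intro picard_diff_le[OF L k] continuous_on_apply_bcontfun norm_ge_zero)
    with half[OF norm_ge_zero[of "y - z"]] show ?thesis by linarith
  qed
  define \<Phi> :: "'a \<Rightarrow> (real \<Rightarrow>\<^sub>C 'a) \<Rightarrow> (real \<Rightarrow>\<^sub>C 'a)"
    where "\<Phi> p y = Bcontfun (picard F k p y)" for p y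
  have \<Phi>: "\<Phi> p y t = picard F k p y t" for p y t
    unfolding \<Phi>_def by (simp add: Bcontfun_inverse picard_bcontfun[OF L k apply_bcontfun])
  have "\<exists>!y. \<Phi> p y = y" for p
  proof (rule banach_fix_type[of "1/2"])
    show "\<forall>y z. dist (\<Phi> p y) (\<Phi> p z) \<le> 1 / 2 * dist y z"
    proof (intro allI)
      fix y z
      have "norm ((\<Phi> p y - \<Phi> p z) t) \<le> norm (y - z) / 2" for t
        using *[of p y t p z] by (simp add: \<Phi>)
      then have "norm (\<Phi> p y - \<Phi> p z) \<le> norm (y - z) / 2" by (rule norm_bound)
      then show "dist (\<Phi> p y) (\<Phi> p z) \<le> 1 / 2 * dist y z" by (simp add: dist_norm)
    qed
  qed auto
  then obtain Y where Y: "\<And>p. \<Phi> p (Y p) = Y p" by metis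
  \<comment> \<open>Removing the weight turns the fixed point into a solution of the integral
    equation for all nonnegative times at once.\<close>
  define X where "X p t = exp (k * t) *\<^sub>R Y p t" for p t
  have X: "X p t = p + integral {0..t} (\<lambda>s. F (X p s))" if "0 \<le> t" for p t
    unfolding X_def using that
    by (subst Y[symmetric, of p], subst \<Phi>) (simp add: picard_def flip: exp_add)
  show thesis
  proof
    show "X p 0 = p" for p
      using X[of 0 p] by simp
    show "(X p has_vector_derivative F (X p t)) (at t within {0..})" if t: "0 \<le> t" for p t
    proof -
      have F: "continuous_on UNIV F" using L by (rule lipschitz_on_continuous_on)
      have cF: "continuous_on {0..t+1} (\<lambda>s. F (X p s))"
        unfolding X_def by (intro continuous_on_compose2[OF F] continuous_intros) auto
      have "((\<lambda>u. p + integral {0..u} (\<lambda>s. F (X p s))) has_vector_derivative 0 + F (X p t))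
          (at t within {0..t+1})"
        using t by (intro has_vector_derivative_add integral_has_vector_derivative cF) auto
      then have "(X p has_vector_derivative F (X p t)) (at t within {0..t+1})"
        using t by (auto intro: has_vector_derivative_transform[rotated 2] simp: X)
      moreover have "at t within {0..t+1} = at t within {0..}"
        using t by (intro at_within_nhd[of _ "{..<t+1}"]) auto
      ultimately show ?thesis by simp
    qed
    show "norm (X p t - X q t) \<le> 2 * exp ((2 * L + 1) * t) * norm (p - q)" if "0 \<le> t" for p q t
    proof -
      \<comment> \<open>The estimate \<open>*\<close> applied to the two fixed points; absorbing the
        last term on the left produces the factor \<open>2\<close>.\<close>
      have "norm (Y p - Y q) \<le> norm (p - q) + norm (Y p - Y q) / 2"
        using *[of p "Y p" _ q "Y q"] by (intro norm_bound) (simp flip: \<Phi> add: Y)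
      moreover have "norm (Y p t - Y q t) \<le> norm (Y p - Y q)"
        using norm_bounded[of "Y p - Y q" t] by simp
      ultimately have "norm (Y p t - Y q t) \<le> 2 * norm (p - q)" by linarith
      then have "exp (k * t) * norm (Y p t - Y q t) \<le> exp (k * t) * (2 * norm (p - q))"
        by simp
      then show ?thesis
        by (simp add: X_def k_def mult_ac flip: scaleR_diff_right)
    qed
  qed
qed

text \<open>At a time \<open>r\<close> where the exponentially weighted distance is largest, the
  integral equation bounds this maximum by half of itself. So it is \<open>0\<close>.\<close>

lemma lipschitz_ode_unique:
  fixes F :: "'a::banach \<Rightarrow> 'a"
  assumes L: "L-lipschitz_on UNIV F"
    and x: "\<And>t. t \<in> {0..T} \<Longrightarrow> (x has_vector_derivative F (x t)) (at t within {0..T})"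
    and y: "\<And>t. t \<in> {0..T} \<Longrightarrow> (y has_vector_derivative F (y t)) (at t within {0..T})"
    and init: "x 0 = y 0" and t: "t \<in> {0..T}"
  shows "x t = y t"
proof -
  define k where "k = 2 * L + 1"
  have L0: "0 \<le> L" using L by (rule lipschitz_on_nonneg)
  then have k: "0 < k" and Lk: "L / k \<le> 1 / 2" by (auto simp: k_def field_simps)
  have F: "continuous_on UNIV F" using L by (rule lipschitz_on_continuous_on)
  have cx: "continuous_on {0..T} x" and cy: "continuous_on {0..T} y"
    unfolding continuous_on_eq_continuous_within
    using has_vector_derivative_continuous[OF x] has_vector_derivative_continuous[OF y] by blast+
  let ?d = "\<lambda>s. exp (- k * s) * norm (x s - y s)"
  have "continuous_on {0..T} ?d" by (intro continuous_intros cx cy)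
  then obtain r where r: "r \<in> {0..T}" and max: "\<And>s. s \<in> {0..T} \<Longrightarrow> ?d s \<le> ?d r"
    using continuous_attains_sup[of "{0..T}" ?d] t by auto
  have sub: "{0..r} \<subseteq> {0..T}" using r by auto
  have d_le: "norm (x s - y s) \<le> ?d r * exp (k * s)" if "s \<in> {0..T}" for s
    using max[OF that] by (simp add: exp_minus field_simps)
  have "((\<lambda>s. F (x s) - F (y s)) has_integral (x r - y r) - (x 0 - y 0)) {0..r}"
    using r sub
    by (intro fundamental_theorem_of_calculus has_vector_derivative_diff
        has_vector_derivative_within_subset[OF x] has_vector_derivative_within_subset[OF y]) auto
  then have "norm (x r - y r) = norm (integral {0..r} (\<lambda>s. F (x s) - F (y s)))"
    using init by (simp add: integral_unique)
  also have "\<dots> \<le> (L * ?d r) / k * exp (k * r)"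
  proof (rule norm_integral_le_exp)
    show "continuous_on {0..r} (\<lambda>s. F (x s) - F (y s))"
      using sub by (intro continuous_intros continuous_on_compose2[OF F]
          continuous_on_subset[OF cx] continuous_on_subset[OF cy]) auto
    fix s assume "s \<in> {0..r}"
    then have "s \<in> {0..T}" using sub by auto
    have "norm (F (x s) - F (y s)) \<le> L * norm (x s - y s)"
      using lipschitz_on_normD[OF L] by auto
    also have "\<dots> \<le> L * (?d r * exp (k * s))"
      using L0 d_le[OF \<open>s \<in> {0..T}\<close>] by (rule mult_left_mono[rotated])
    finally show "norm (F (x s) - F (y s)) \<le> L * ?d r * exp (k * s)" by simp
  qed (use k L0 r in auto)
  also have "\<dots> = L / k * norm (x r - y r)"
    by (simp add: mult_ac flip: exp_add)
  also have "\<dots> \<le> 1 / 2 * norm (x r - y r)"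
    using Lk by (rule mult_right_mono) simp
  finally have "norm (x r - y r) = 0" using norm_ge_zero[of "x r - y r"] by linarith
  with d_le[OF t] have "norm (x t - y t) \<le> 0" by (simp only: mult_zero_right mult_zero_left)
  then show ?thesis by (simp only: norm_le_zero_iff right_minus_eq)
qed

section \<open>The semidiscrete right-hand side as a map on bounded sequences\<close>

text \<open>The library has completeness only over metric domains, and \<open>int\<close> is not an instance of \<open>metric_space\<close>.\<close>

instance bcontfun :: (topological_space, complete_space) complete_space
proof
  fix u :: "nat \<Rightarrow> ('a \<Rightarrow>\<^sub>C 'b)"
  assume "Cauchy u"
  then have "uniformly_Cauchy_on UNIV (\<lambda>n. apply_bcontfun (u n))"
    unfolding Cauchy_def uniformly_Cauchy_on_def by (meson dist_bounded le_less_trans)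
  then obtain l where "uniform_limit UNIV (\<lambda>n. apply_bcontfun (u n)) l sequentially"
    using Cauchy_uniformly_convergent unfolding uniformly_convergent_on_def by blast
  then obtain l' where "u \<longlonglongrightarrow> l'"
    by (rule uniform_limit_bcontfunE) simp
  then show "convergent u" by (rule convergentI)
qed

instance bcontfun :: (topological_space, banach) banach ..

text \<open>Young's inequality for a summable kernel against a bounded sequence. It is stated for
  differences so that it gives Lipschitz bounds, and plain bounds by taking
  \<open>z = 0\<close>.\<close>

lemma discrete_conv_diff_le:
  assumes a: "(\<lambda>i. norm (a i)) summable_on UNIV" and "0 < h"
    and w: "bounded (range w)" and z: "bounded (range z)"
    and le: "\<And>j. \<bar>w j - z j\<bar> \<le> M"
  shows "\<bar>discrete_conv h a w i - discrete_conv h a z i\<bar> \<le> h * (\<Sum>\<^sub>\<infinity>j. norm (a j)) * M"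
proof -
  \<comment> \<open>The reflection \<open>j \<mapsto> i - j\<close> is its own inverse, so the
    kernel sum does not depend on \<open>i\<close>.\<close>
  have bij: "bij_betw (\<lambda>j. i - j) UNIV (UNIV :: int set)"
    by (rule bij_betwI[of _ _ _ "\<lambda>j. i - j"]) auto
  have ai: "(\<lambda>j. norm (a (i - j))) summable_on UNIV"
    using summable_on_reindex_bij_betw[OF bij, of "\<lambda>j. norm (a j)"] a by simp
  have abs_sum: "(\<lambda>j. norm (h * a (i - j) * y j)) summable_on UNIV"
    if "\<And>j. \<bar>y j\<bar> \<le> B" for y :: "int \<Rightarrow> real" and B
  proof (rule summable_on_comparison_test)
    show "(\<lambda>j. h * B * norm (a (i - j))) summable_on UNIV"
      by (rule summable_on_cmult_right[OF ai])
    show "norm (h * a (i - j) * y j) \<le> h * B * norm (a (i - j))" for j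
      using mult_right_mono[OF that[of j], of "h * \<bar>a (i - j)\<bar>"] \<open>0 < h\<close>
      by (simp add: abs_mult ac_simps)
  qed simp
  obtain B where B: "\<And>j. \<bar>z j\<bar> \<le> B" using z by (auto simp: bounded_iff)
  let ?d = "\<lambda>j. w j - z j"
  note d = abs_sum[of ?d M, OF le]
  have "discrete_conv h a w i = (\<Sum>\<^sub>\<infinity>j. h * a (i - j) * ?d j + h * a (i - j) * z j)"
    unfolding discrete_conv_def by (simp add: algebra_simps)
  also have "\<dots> = (\<Sum>\<^sub>\<infinity>j. h * a (i - j) * ?d j) + discrete_conv h a z i"
    unfolding discrete_conv_def
    by (rule infsum_add; rule abs_summable_summable; rule abs_sum) (rule le B)+
  finally have "\<bar>discrete_conv h a w i - discrete_conv h a z i\<bar> = norm (\<Sum>\<^sub>\<infinity>j. h * a (i - j) * ?d j)"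
    by simp
  also have "\<dots> \<le> (\<Sum>\<^sub>\<infinity>j. norm (h * a (i - j) * ?d j))"
    by (rule norm_infsum_bound[OF d])
  also have "\<dots> \<le> (\<Sum>\<^sub>\<infinity>j. h * M * norm (a (i - j)))"
    by (rule infsum_mono[OF d summable_on_cmult_right[OF ai]])
       (use mult_right_mono[OF le, of "h * \<bar>a (i - _)\<bar>"] \<open>0 < h\<close> in \<open>simp add: abs_mult ac_simps\<close>)
  also have "\<dots> = h * M * (\<Sum>\<^sub>\<infinity>j. norm (a j))"
    using infsum_reindex_bij_betw[OF bij, of "\<lambda>j. norm (a j)"] by (simp only: infsum_cmult_right')
  finally show ?thesis by (simp add: mult_ac)
qed

section \<open>Bounds for the difference operators\<close>

lemma diff_minus_diff_le:
  assumes "0 < h" "\<And>i. \<bar>u i - v i\<bar> \<le> K"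
  shows "\<bar>diff_minus h u i - diff_minus h v i\<bar> \<le> 2 / h * K"
proof -
  have "diff_minus h u i - diff_minus h v i = ((u i - v i) - (u (i - 1) - v (i - 1))) / h"
    by (simp add: diff_minus_def diff_divide_distrib)
  moreover have "\<bar>(u i - v i) - (u (i - 1) - v (i - 1))\<bar> \<le> 2 * K"
    using assms(2)[of i] assms(2)[of "i - 1"] by linarith
  ultimately show ?thesis using \<open>0 < h\<close> by (simp add: divide_right_mono)
qed

text \<open>Lets the one estimate \<open>diff_minus_diff_le\<close> serve for both difference
  operators.\<close>

lemma diff_plus_eq_diff_minus: "diff_plus h u i = diff_minus h u (i + 1)"
  by (simp add: diff_plus_def diff_minus_def)

lemma diff_plus_diff_minus_conv_diff_le:
  assumes "(\<lambda>i. norm (a i)) summable_on UNIV" "0 < h"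
    and "bounded (range w)" "bounded (range z)" "\<And>j. \<bar>w j - z j\<bar> \<le> M"
  shows "\<bar>diff_plus h (diff_minus h (discrete_conv h a w)) i
        - diff_plus h (diff_minus h (discrete_conv h a z)) i\<bar>
    \<le> 2 / h * (2 / h * (h * (\<Sum>\<^sub>\<infinity>j. norm (a j)) * M))"
  unfolding diff_plus_eq_diff_minus
  by (intro diff_minus_diff_le discrete_conv_diff_le assms)

section \<open>The nonlinearity and its truncation\<close>

lemma bounded_range_lipschitz:
  fixes y :: "'a \<Rightarrow> real" and f :: "real \<Rightarrow> real"
  assumes "L-lipschitz_on UNIV f" "bounded (range y)"
  shows "bounded (range (\<lambda>j. f (y j)))"
proof -
  have "uniformly_continuous_on (range y) f"
    by (rule lipschitz_on_uniformly_continuous[OF lipschitz_on_subset[OF assms(1) subset_UNIV]])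
  then have "bounded (f ` range y)" using assms(2) by (intro bounded_uniformly_continuous_image)
  then show ?thesis by (simp add: image_image)
qed

lemma locally_lipschitz_Icc:
  assumes "locally_lipschitz f"
  obtains L where "L-lipschitz_on {a..b} f"
proof -
  \<comment> \<open>A one-point time set casts \<open>f\<close> as a time-dependent field, for which
    compactness turns local Lipschitz bounds into a single one.\<close>
  have "local_lipschitz {0::real} {a..b} (\<lambda>_. f)"
  proof (rule local_lipschitzI)
    fix x
    obtain r L where "r > 0" "L-lipschitz_on (ball x r) f"
      using assms unfolding locally_lipschitz_def by blast
    moreover have "cball x (r / 2) \<inter> {a..b} \<subseteq> ball x r"
      using \<open>r > 0\<close> by auto
    ultimately show "\<exists>u>0. \<exists>L. \<forall>t\<in>cball t u \<inter> {0}. L-lipschitz_on (cball x u \<inter> {a..b}) f" for t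
      by (intro exI[of _ "r / 2"]) (auto intro: lipschitz_on_subset)
  qed
  then show thesis
    by (rule local_lipschitz_compact_implies_lipschitz) (auto intro: that)
qed

text \<open>The argument is clamped, instead of \<open>f\<close> being multiplied by a cutoff:
  clamping does not increase distances, so a Lipschitz constant of \<open>f\<close> on a compact
  interval serves on the whole line.\<close>

definition truncate :: "real \<Rightarrow> (real \<Rightarrow> real) \<Rightarrow> real \<Rightarrow> real" where
  "truncate R f x = f (max (- R) (min R x))"

lemma truncate_eq: "\<bar>x\<bar> \<le> R \<Longrightarrow> truncate R f x = f x"
  unfolding truncate_def by (rule arg_cong[of _ _ f]) auto

lemma lipschitz_truncate:
  assumes "locally_lipschitz f"
  obtains L where "L-lipschitz_on UNIV (truncate R f)"
proof -
  \<comment> \<open>For negative \<open>R\<close> the clamp is constantly \<open>- R\<close>; the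
    absolute values cover this case too.\<close>
  obtain L where L: "L-lipschitz_on {- \<bar>R\<bar>..\<bar>R\<bar>} f"
    using locally_lipschitz_Icc[OF assms] by blast
  have "L-lipschitz_on UNIV (truncate R f)"
  proof (rule lipschitz_onI)
    fix x y :: real
    let ?c = "\<lambda>x. max (- R) (min R x)"
    have "dist (f (?c x)) (f (?c y)) \<le> L * dist (?c x) (?c y)"
      by (rule lipschitz_onD[OF L]) auto
    also have "\<dots> \<le> L * dist x y"
      by (intro mult_left_mono lipschitz_on_nonneg[OF L]) (auto simp: dist_real_def)
    finally show "dist (truncate R f x) (truncate R f y) \<le> L * dist x y"
      by (simp add: truncate_def)
  qed (rule lipschitz_on_nonneg[OF L])
  then show thesis by (rule that)
qed

text \<open>\<open>Bcontfun\<close> has the intended value only at bounded sequences; that the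
  right-hand side is bounded is part of the proofs of \<open>rhs_linf_apply_lipschitz\<close> and
  \<open>rhs_linf_apply\<close>.\<close>

definition rhs_linf :: "real \<Rightarrow> (real \<Rightarrow> real) \<Rightarrow> (real \<Rightarrow> real) \<Rightarrow> linf \<Rightarrow> linf" where
  "rhs_linf h \<beta> f v = Bcontfun (semidiscrete_rhs h \<beta> f v)"

lemma bounded_range_linf: "bounded (range (apply_bcontfun (v :: linf)))"
  using apply_bcontfun[of v] by (simp add: bcontfun_linf_iff)

lemma rhs_linf_apply_lipschitz:
  assumes a: "(\<lambda>i. norm (grid_restriction h \<beta> i)) summable_on UNIV" and "0 < h"
    and f: "L-lipschitz_on UNIV f"
  shows "rhs_linf h \<beta> f v i = semidiscrete_rhs h \<beta> f v i"
proof -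
  have fv: "bounded (range (\<lambda>j. f (v j)))"
    by (rule bounded_range_lipschitz[OF f bounded_range_linf])
  \<comment> \<open>The difference estimate is used with the zero sequence as second argument, whose
    image under the linear operators is zero.\<close>
  then obtain B where "\<And>j. \<bar>f (v j) - 0\<bar> \<le> B" by (auto simp: bounded_iff)
  from diff_plus_diff_minus_conv_diff_le[OF a \<open>0 < h\<close> fv _ this]
  have "bounded (range (semidiscrete_rhs h \<beta> f v))"
    unfolding semidiscrete_rhs_def
    by (auto simp: bounded_iff diff_plus_def diff_minus_def discrete_conv_def)
  then show ?thesis by (simp add: rhs_linf_def Bcontfun_inverse bcontfun_linf_iff)
qed

lemma rhs_linf_lipschitz:
  assumes a: "(\<lambda>i. norm (grid_restriction h \<beta> i)) summable_on UNIV" and "0 < h"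
    and f: "L-lipschitz_on UNIV f"
  obtains C where "C-lipschitz_on UNIV (rhs_linf h \<beta> f)"
proof -
  \<comment> \<open>One factor \<open>2 / h\<close> for each difference operator, \<open>h\<close>
    times the kernel sum for the convolution, and \<open>L\<close> for \<open>f\<close>.\<close>
  define C where "C = 2 / h * (2 / h * (h * (\<Sum>\<^sub>\<infinity>j. norm (grid_restriction h \<beta> j)) * L))"
  have "C-lipschitz_on UNIV (rhs_linf h \<beta> f)"
  proof (rule lipschitz_onI)
    fix v w :: linf
    have "\<bar>f (v j) - f (w j)\<bar> \<le> L * norm (v - w)" for j
      using lipschitz_on_normD[OF f, of "v j" "w j"]
        mult_left_mono[OF norm_bounded[of "v - w" j] lipschitz_on_nonneg[OF f]] by simp
    note diff_plus_diff_minus_conv_diff_le[OF a \<open>0 < h\<close> bounded_range_lipschitz[OF f bounded_range_linf]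
        bounded_range_lipschitz[OF f bounded_range_linf] this, folded semidiscrete_rhs_def]
    then have "norm ((rhs_linf h \<beta> f v - rhs_linf h \<beta> f w) i) \<le> C * norm (v - w)" for i
      by (simp only: minus_bcontfun.rep_eq rhs_linf_apply_lipschitz[OF a \<open>0 < h\<close> f] C_def
          mult.assoc real_norm_def)
    then show "dist (rhs_linf h \<beta> f v) (rhs_linf h \<beta> f w) \<le> C * dist v w"
      unfolding dist_norm by (rule norm_bound)
  next
    show "0 \<le> C"
      unfolding C_def using \<open>0 < h\<close> lipschitz_on_nonneg[OF f] by (simp add: infsum_nonneg)
  qed
  then show thesis by (rule that)
qed

section \<open>The initial-value problem\<close>

lemma norm_fst_diff_le: "norm (fst x - fst y) \<le> norm (x - y)"
  and norm_snd_diff_le: "norm (snd x - snd y) \<le> norm (x - y)"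
  by (cases x; cases y; simp add: norm_fst_le norm_snd_le)+

locale semidiscrete_ivp =
  fixes h :: real and \<beta> f :: "real \<Rightarrow> real"
  assumes summable: "(\<lambda>i. norm (grid_restriction h \<beta> i)) summable_on UNIV"
    and h_pos: "0 < h" and loc_lip: "locally_lipschitz f"
begin

text \<open>The first-order system for the pair \<open>(v, v')\<close>. The nonlinearity is a
  parameter so that \<open>f\<close> and its truncations share the definition.\<close>

definition field :: "(real \<Rightarrow> real) \<Rightarrow> linf \<times> linf \<Rightarrow> linf \<times> linf" where
  "field k x = (snd x, rhs_linf h \<beta> k (fst x))"

lemma rhs_linf_truncate:
  assumes "norm v \<le> R"
  shows "rhs_linf h \<beta> (truncate R f) v = rhs_linf h \<beta> f v"
proof -
  have "\<bar>v j\<bar> \<le> R" for j using norm_bounded[of v j] assms by simp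
  then have "(\<lambda>j. truncate R f (v j)) = (\<lambda>j. f (v j))" by (simp add: truncate_eq)
  then show ?thesis by (simp add: rhs_linf_def semidiscrete_rhs_def)
qed

lemma field_truncate: "norm (fst x) \<le> R \<Longrightarrow> field (truncate R f) x = field f x"
  by (simp add: field_def rhs_linf_truncate)

text \<open>At a single \<open>v\<close> truncation at the level \<open>norm v\<close> changes
  nothing, which reduces the claim to the globally Lipschitz case.\<close>

lemma rhs_linf_apply: "rhs_linf h \<beta> f v i = semidiscrete_rhs h \<beta> f v i"
proof -
  obtain L where L: "L-lipschitz_on UNIV (truncate (norm v) f)"
    using lipschitz_truncate[OF loc_lip] by blast
  have "\<bar>v j\<bar> \<le> norm v" for j using norm_bounded[of v j] by simp
  then have "semidiscrete_rhs h \<beta> (truncate (norm v) f) v = semidiscrete_rhs h \<beta> f v"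
    by (simp add: semidiscrete_rhs_def truncate_eq)
  then show ?thesis
    using rhs_linf_apply_lipschitz[OF summable h_pos L, of v i] by (simp add: rhs_linf_truncate)
qed

lemma rhs_linf_truncate_lipschitz:
  obtains C where "C-lipschitz_on UNIV (rhs_linf h \<beta> (truncate R f))"
  using lipschitz_truncate[OF loc_lip] rhs_linf_lipschitz[OF summable h_pos] by metis

text \<open>Continuity is local: with the level \<open>norm v + 1\<close> the truncated and the
  original map agree on a whole neighbourhood of \<open>v\<close>.\<close>

lemma continuous_on_rhs_linf: "continuous_on S (rhs_linf h \<beta> f)"
proof -
  have "isCont (rhs_linf h \<beta> f) v" for v
  proof -
    obtain C where "C-lipschitz_on UNIV (rhs_linf h \<beta> (truncate (norm v + 1) f))"
      using rhs_linf_truncate_lipschitz by blast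
    then have "isCont (rhs_linf h \<beta> (truncate (norm v + 1) f)) v"
      using lipschitz_on_continuous_on continuous_on_eq_continuous_at open_UNIV by blast
    moreover have "eventually (\<lambda>w. rhs_linf h \<beta> (truncate (norm v + 1) f) w = rhs_linf h \<beta> f w) (nhds v)"
    proof -
      have "open {w::linf. norm w < norm v + 1}" by (intro open_Collect_less continuous_intros)
      then have "eventually (\<lambda>w. norm w < norm v + 1) (nhds v)"
        by (auto dest: eventually_nhds_in_open[of _ v])
      then show ?thesis by eventually_elim (simp add: rhs_linf_truncate)
    qed
    ultimately show ?thesis by (simp add: isCont_cong)
  qed
  then show ?thesis by (simp add: continuous_at_imp_continuous_on)
qed

lemma field_truncate_lipschitz:
  obtains C where "C-lipschitz_on UNIV (field (truncate R f))"
proof -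
  obtain C where C: "C-lipschitz_on UNIV (rhs_linf h \<beta> (truncate R f))"
    by (rule rhs_linf_truncate_lipschitz)
  have fst1: "1-lipschitz_on UNIV (fst :: linf \<times> linf \<Rightarrow> linf)"
    and snd1: "1-lipschitz_on UNIV (snd :: linf \<times> linf \<Rightarrow> linf)"
    by (rule lipschitz_onI; simp add: dist_fst_le dist_snd_le)+
  have "(C * 1)-lipschitz_on UNIV (\<lambda>x :: linf \<times> linf. rhs_linf h \<beta> (truncate R f) (fst x))"
    by (rule lipschitz_on_compose2[OF fst1 lipschitz_on_subset[OF C subset_UNIV]])
  note pair = lipschitz_on_Pair[OF snd1 this]
  have eq: "field (truncate R f) = (\<lambda>x. (snd x, rhs_linf h \<beta> (truncate R f) (fst x)))"
    by (simp add: field_def fun_eq_iff)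
  show thesis by (rule that, subst eq, rule pair)
qed

text \<open>Continuity of \<open>v''\<close> need not be carried along in the first-order form:
  \<open>v\<close> is continuous by differentiability, and the right-hand side depends continuously
  on \<open>v\<close>.\<close>

lemma ivp_solution_derivs_iff:
  "ivp_solution_derivs h \<beta> f \<phi> \<psi> S v v' v'' \<longleftrightarrow>
     v 0 = \<phi> \<and> v' 0 = \<psi> \<and> (\<forall>t\<in>S. v'' t = rhs_linf h \<beta> f (v t)) \<and>
     (\<forall>t\<in>S. ((\<lambda>t. (v t, v' t)) has_vector_derivative field f (v t, v' t)) (at t within S))"
  (is "?L \<longleftrightarrow> ?R")
proof
  assume ?L
  then show ?R
    unfolding ivp_solution_derivs_def C2_on_def field_def
    by (auto intro!: has_vector_derivative_Pair bcontfun_eqI simp: rhs_linf_apply)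
       (metis bcontfun_eqI rhs_linf_apply)
next
  assume R: ?R
  have v: "(v has_vector_derivative v' t) (at t within S)"
    and v': "(v' has_vector_derivative rhs_linf h \<beta> f (v t)) (at t within S)" if "t \<in> S" for t
  proof -
    have x: "((\<lambda>t. (v t, v' t)) has_vector_derivative field f (v t, v' t)) (at t within S)"
      using R that by blast
    show "(v has_vector_derivative v' t) (at t within S)"
      using bounded_linear.has_vector_derivative[OF bounded_linear_fst x] by (simp add: field_def)
    show "(v' has_vector_derivative rhs_linf h \<beta> f (v t)) (at t within S)"
      using bounded_linear.has_vector_derivative[OF bounded_linear_snd x] by (simp add: field_def)
  qed
  have "continuous_on S v"
    unfolding continuous_on_eq_continuous_within using v has_vector_derivative_continuous by blast
  then have "continuous_on S (\<lambda>t. rhs_linf h \<beta> f (v t))"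
    by (rule continuous_on_compose2[OF continuous_on_rhs_linf _ subset_UNIV])
  then have "continuous_on S v''"
    using R by (simp cong: continuous_on_cong)
  then show ?L
    unfolding ivp_solution_derivs_def C2_on_def using R v v' by (auto simp: rhs_linf_apply)
qed

lemma ivp_solution_derivs_subset:
  assumes "ivp_solution_derivs h \<beta> f \<phi> \<psi> S v v' v''" "S' \<subseteq> S"
  shows "ivp_solution_derivs h \<beta> f \<phi> \<psi> S' v v' v''"
  using assms unfolding ivp_solution_derivs_iff
  by (blast intro: has_vector_derivative_within_subset)

section \<open>Flows of the truncated systems\<close>

lemma truncated_flow_exists:
  "\<exists>X C. (\<forall>p. X p 0 = p) \<and>
     (\<forall>p. \<forall>t\<ge>0. (X p has_vector_derivative field (truncate R f) (X p t)) (at t within {0..})) \<and>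
     (\<forall>p q. \<forall>t\<ge>0. norm (X p t - X q t) \<le> 2 * exp (C * t) * norm (p - q)) \<and> C \<ge> 0"
proof -
  obtain L where L: "L-lipschitz_on UNIV (field (truncate R f))" by (rule field_truncate_lipschitz)
  have "0 \<le> 2 * L + 1" using lipschitz_on_nonneg[OF L] by simp
  moreover obtain X where "\<And>p. X p 0 = p"
    "\<And>p t. 0 \<le> t \<Longrightarrow> (X p has_vector_derivative field (truncate R f) (X p t)) (at t within {0..})"
    "\<And>p q t. 0 \<le> t \<Longrightarrow> norm (X p t - X q t) \<le> 2 * exp ((2 * L + 1) * t) * norm (p - q)"
    using lipschitz_ode_flow[OF L] by blast
  ultimately show ?thesis by (intro exI[of _ X] exI[of _ "2 * L + 1"]) simp
qed

text \<open>For each level \<open>R\<close> one global flow is fixed by choice, so that different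
  levels can be compared and glued later. The growth constant \<open>C\<close> may depend on
  \<open>R\<close>.\<close>

definition flow :: "real \<Rightarrow> linf \<times> linf \<Rightarrow> real \<Rightarrow> linf \<times> linf" where
  "flow R = (SOME X. \<exists>C. (\<forall>p. X p 0 = p) \<and>
     (\<forall>p. \<forall>t\<ge>0. (X p has_vector_derivative field (truncate R f) (X p t)) (at t within {0..})) \<and>
     (\<forall>p q. \<forall>t\<ge>0. norm (X p t - X q t) \<le> 2 * exp (C * t) * norm (p - q)) \<and> C \<ge> 0)"

lemma flow_0: "flow R p 0 = p"
  and flow_has_derivative:
    "0 \<le> t \<Longrightarrow> (flow R p has_vector_derivative field (truncate R f) (flow R p t)) (at t within {0..})"
  and flow_diff_le:
    "\<exists>C\<ge>0. \<forall>p q. \<forall>t\<ge>0. norm (flow R p t - flow R q t) \<le> 2 * exp (C * t) * norm (p - q)"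
  using someI_ex[OF truncated_flow_exists[of R], folded flow_def] by blast+

lemma continuous_on_flow: "S \<subseteq> {0..} \<Longrightarrow> continuous_on S (flow R p)"
  using flow_has_derivative has_vector_derivative_continuous
  by (metis atLeast_iff continuous_on_eq_continuous_within continuous_on_subset)

text \<open>Along a solution that stays within the level \<open>R\<close> the truncated and the
  original field coincide, so uniqueness for the Lipschitz system applies.\<close>

lemma solution_eq_flow:
  assumes sol: "ivp_solution_derivs h \<beta> f \<phi> \<psi> {0..T} v v' v''"
    and bound: "\<And>t. t \<in> {0..T} \<Longrightarrow> norm (v t) \<le> R" and t: "t \<in> {0..T}"
  shows "(v t, v' t) = flow R (\<phi>, \<psi>) t"
proof -
  obtain C where C: "C-lipschitz_on UNIV (field (truncate R f))" by (rule field_truncate_lipschitz)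
  show ?thesis
  proof (rule lipschitz_ode_unique[OF C _ _ _ t])
    show "((\<lambda>t. (v t, v' t)) has_vector_derivative field (truncate R f) (v s, v' s)) (at s within {0..T})"
      if "s \<in> {0..T}" for s
      using sol bound[OF that] that unfolding ivp_solution_derivs_iff by (simp add: field_truncate)
    show "(flow R (\<phi>, \<psi>) has_vector_derivative field (truncate R f) (flow R (\<phi>, \<psi>) s))
        (at s within {0..T})" if "s \<in> {0..T}" for s
      using that by (intro has_vector_derivative_within_subset[OF flow_has_derivative]) auto
    show "(v 0, v' 0) = flow R (\<phi>, \<psi>) 0"
      using sol unfolding ivp_solution_derivs_iff by (simp add: flow_0)
  qed
qed

lemma flow_solution:
  assumes "S \<subseteq> {0..}" "\<And>t. t \<in> S \<Longrightarrow> norm (fst (flow R p t)) \<le> R"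
  shows "ivp_solution_derivs h \<beta> f (fst p) (snd p) S (\<lambda>t. fst (flow R p t))
    (\<lambda>t. snd (flow R p t)) (\<lambda>t. rhs_linf h \<beta> f (fst (flow R p t)))"
proof -
  have "(flow R p has_vector_derivative field f (flow R p t)) (at t within S)" if "t \<in> S" for t
    using has_vector_derivative_within_subset[OF flow_has_derivative assms(1), of t R p] assms that
    by (auto simp: field_truncate subset_iff)
  then show ?thesis unfolding ivp_solution_derivs_iff by (simp add: flow_0)
qed

section \<open>Uniqueness on compact time intervals\<close>

lemma solution_bounded:
  assumes "ivp_solution_derivs h \<beta> f \<phi> \<psi> {0..T} v v' v''"
  obtains R where "\<And>t. t \<in> {0..T} \<Longrightarrow> norm (v t) \<le> R"
proof -
  have "continuous_on {0..T} v"
    using assms unfolding ivp_solution_derivs_def C2_on_def continuous_on_eq_continuous_within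
    by (blast intro: has_vector_derivative_continuous)
  then have "compact (v ` {0..T})" by (rule compact_continuous_image) simp
  then have "bounded (v ` {0..T})" by (rule compact_imp_bounded)
  then obtain R where "\<forall>t\<in>{0..T}. norm (v t) \<le> R" by (auto simp: bounded_iff)
  then show thesis by (intro that) blast
qed

text \<open>By compactness both solutions are bounded, and both equal the truncated flow at a common
  level.\<close>

lemma solutions_agree:
  assumes v: "ivp_solution_derivs h \<beta> f \<phi> \<psi> {0..T} v v' v''"
    and w: "ivp_solution_derivs h \<beta> f \<phi> \<psi> {0..T} w w' w''" and t: "t \<in> {0..T}"
  shows "(w t, w' t) = (v t, v' t)"
proof -
  obtain R where R: "\<And>t. t \<in> {0..T} \<Longrightarrow> norm (v t) \<le> R" using solution_bounded[OF v] by blast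
  obtain Q where Q: "\<And>t. t \<in> {0..T} \<Longrightarrow> norm (w t) \<le> Q" using solution_bounded[OF w] by blast
  have "(v t, v' t) = flow (max R Q) (\<phi>, \<psi>) t"
    using R by (intro solution_eq_flow[OF v _ t]) (simp add: le_max_iff_disj)
  moreover have "(w t, w' t) = flow (max R Q) (\<phi>, \<psi>) t"
    using Q by (intro solution_eq_flow[OF w _ t]) (simp add: le_max_iff_disj)
  ultimately show ?thesis by simp
qed

section \<open>Local well-posedness\<close>

lemma well_posed: "locally_well_posed h \<beta> f"
  unfolding locally_well_posed_def
proof
  fix p0 :: "linf \<times> linf"
  \<comment> \<open>One unit of room for the motion in time of the flow from \<open>p0\<close>, one
    for the change of the data.\<close>
  define R where "R = norm (fst p0) + 2"
  obtain C where C: "0 \<le> C" "\<And>p q t. 0 \<le> t \<Longrightarrow> norm (flow R p t - flow R q t) \<le> 2 * exp (C * t) * norm (p - q)"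
    using flow_diff_le[of R] by blast
  have "continuous_on {0..} (\<lambda>t. fst (flow R p0 t))" by (intro continuous_intros continuous_on_flow) simp
  then have "\<exists>d>0. \<forall>t\<in>{0..}. dist t 0 < d \<longrightarrow> dist (fst (flow R p0 t)) (fst (flow R p0 0)) < 1"
    unfolding continuous_on_iff by (auto dest: bspec[of _ _ 0] spec[of _ "1::real"])
  then obtain d where d: "d > 0" "\<And>t. 0 \<le> t \<Longrightarrow> t < d \<Longrightarrow> dist (fst (flow R p0 t)) (fst p0) < 1"
    by (auto simp: flow_0 dist_real_def)
  \<comment> \<open>The bound \<open>T \<le> 1\<close> gives \<open>exp (C * t) \<le> exp C\<close>,
    and \<open>d / 2\<close> keeps the closed interval \<open>[0, T]\<close> strictly below
    \<open>d\<close>.\<close>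
  define T where "T = min 1 (d / 2)"
  define K where "K = 2 * exp C"
  \<comment> \<open>\<open>K\<close> is a Lipschitz constant of the flow in the data on
    \<open>[0, T]\<close>, so data in this ball displace the flow by at most
    \<open>1\<close>.\<close>
  define r where "r = 1 / K"
  have T: "0 < T" "T \<le> 1" "T < d" using d by (auto simp: T_def)
  have K: "0 < K" by (simp add: K_def)
  have r: "0 < r" using K by (simp add: r_def)
  have lip: "norm (flow R p t - flow R q t) \<le> K * norm (p - q)" if "t \<in> {0..T}" for p q t
  proof -
    have "norm (flow R p t - flow R q t) \<le> 2 * exp (C * t) * norm (p - q)" using C(2) that by simp
    also have "C * t \<le> C * 1" using that T C(1) by (intro mult_left_mono) auto
    then have "2 * exp (C * t) * norm (p - q) \<le> K * norm (p - q)"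
      unfolding K_def by (intro mult_right_mono) auto
    finally show ?thesis .
  qed
  have bound: "norm (fst (flow R p t)) \<le> R" if t: "t \<in> {0..T}" and p: "p \<in> ball p0 r" for p t
  proof -
    have "norm (p - p0) \<le> 1 / K" using p by (simp add: dist_norm norm_minus_commute r_def)
    then have "K * norm (p - p0) \<le> 1" using K by (simp add: field_simps)
    with lip[OF t, of p p0] have "norm (flow R p t - flow R p0 t) \<le> 1" by linarith
    then have "norm (fst (flow R p t) - fst (flow R p0 t)) \<le> 1"
      using norm_fst_diff_le order_trans by blast
    moreover have "norm (fst (flow R p0 t) - fst p0) < 1" using d(2)[of t] t T by (simp add: dist_norm)
    ultimately show ?thesis
      using R_def norm_triangle_sub[of "fst (flow R p t)" "fst (flow R p0 t)"]
        norm_triangle_sub[of "fst (flow R p0 t)" "fst p0"] by linarith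
  qed
  have sol: "ivp_solution_derivs h \<beta> f (fst p) (snd p) {0..T} (\<lambda>t. fst (flow R p t))
      (\<lambda>t. snd (flow R p t)) (\<lambda>t. rhs_linf h \<beta> f (fst (flow R p t)))" if "p \<in> ball p0 r" for p
    by (rule flow_solution) (use bound that in auto)
  obtain M where M: "M-lipschitz_on UNIV (rhs_linf h \<beta> (truncate R f))"
    by (rule rhs_linf_truncate_lipschitz)
  \<comment> \<open>A Lipschitz bound in the data that is uniform in time yields the uniform limit.
    The sign of \<open>B\<close> is not assumed, hence \<open>|B|\<close> in the proof.\<close>
  have unif: "uniform_limit {0..T} V (V p) (at p within ball p0 r)"
    if V: "\<And>q t. t \<in> {0..T} \<Longrightarrow> q \<in> ball p0 r \<Longrightarrow> norm (V q t - V p t) \<le> B * norm (q - p)"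
    for V :: "linf \<times> linf \<Rightarrow> real \<Rightarrow> linf" and p B
  proof (rule uniform_limitI)
    fix e :: real assume "0 < e"
    have "((\<lambda>q. \<bar>B\<bar> * norm (q - p)) \<longlongrightarrow> \<bar>B\<bar> * norm (p - p)) (at p within ball p0 r)"
      by (intro tendsto_intros)
    then have "eventually (\<lambda>q. \<bar>B\<bar> * norm (q - p) < e) (at p within ball p0 r)"
      using \<open>0 < e\<close> by (intro order_tendstoD(2)) auto
    moreover have "eventually (\<lambda>q. q \<in> ball p0 r) (at p within ball p0 r)"
      by (simp add: eventually_at_filter)
    ultimately show "\<forall>\<^sub>F q in at p within ball p0 r. \<forall>t\<in>{0..T}. dist (V q t) (V p t) < e"
    proof eventually_elim
      case (elim q)
      have "B * norm (q - p) \<le> \<bar>B\<bar> * norm (q - p)" by (intro mult_right_mono) auto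
      then show ?case using V[OF _ elim(2)] elim(1) by (force simp: dist_norm)
    qed
  qed
  have lip_fst: "norm (fst (flow R q t) - fst (flow R p t)) \<le> K * norm (q - p)" if "t \<in> {0..T}" for p q t
    using norm_fst_diff_le lip[OF that] by (rule order_trans)
  have lip_snd: "norm (snd (flow R q t) - snd (flow R p t)) \<le> K * norm (q - p)" if "t \<in> {0..T}" for p q t
    using norm_snd_diff_le lip[OF that] by (rule order_trans)
  \<comment> \<open>Both flows stay within the level \<open>R\<close>, where \<open>f\<close> may be
    replaced by its truncation with Lipschitz constant \<open>M\<close>.\<close>
  have lip_rhs: "norm (rhs_linf h \<beta> f (fst (flow R q t)) - rhs_linf h \<beta> f (fst (flow R p t)))
      \<le> M * K * norm (q - p)" if "t \<in> {0..T}" "p \<in> ball p0 r" "q \<in> ball p0 r" for p q t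
  proof -
    have "norm (rhs_linf h \<beta> f (fst (flow R q t)) - rhs_linf h \<beta> f (fst (flow R p t)))
        \<le> M * norm (fst (flow R q t) - fst (flow R p t))"
      using lipschitz_on_normD[OF M, of "fst (flow R q t)" "fst (flow R p t)"] bound that
      by (simp add: rhs_linf_truncate)
    also have "\<dots> \<le> M * (K * norm (q - p))"
      by (intro mult_left_mono lip_fst that lipschitz_on_nonneg[OF M])
    finally show ?thesis by simp
  qed
  have "\<forall>p\<in>ball p0 r.
      ivp_solution_derivs h \<beta> f (fst p) (snd p) {0..T} (\<lambda>t. fst (flow R p t)) (\<lambda>t. snd (flow R p t))
        (\<lambda>t. rhs_linf h \<beta> f (fst (flow R p t))) \<and>
      (\<forall>w. ivp_solution h \<beta> f (fst p) (snd p) {0..T} w \<longrightarrow> (\<forall>t\<in>{0..T}. w t = fst (flow R p t))) \<and>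
      uniform_limit {0..T} (\<lambda>p t. fst (flow R p t)) (\<lambda>t. fst (flow R p t)) (at p within ball p0 r) \<and>
      uniform_limit {0..T} (\<lambda>p t. snd (flow R p t)) (\<lambda>t. snd (flow R p t)) (at p within ball p0 r) \<and>
      uniform_limit {0..T} (\<lambda>p t. rhs_linf h \<beta> f (fst (flow R p t)))
        (\<lambda>t. rhs_linf h \<beta> f (fst (flow R p t))) (at p within ball p0 r)"
  proof (intro ballI conjI allI impI)
    fix p assume p: "p \<in> ball p0 r"
    show "ivp_solution_derivs h \<beta> f (fst p) (snd p) {0..T} (\<lambda>t. fst (flow R p t)) (\<lambda>t. snd (flow R p t))
        (\<lambda>t. rhs_linf h \<beta> f (fst (flow R p t)))" by (rule sol[OF p])
    show "w t = fst (flow R p t)" if "ivp_solution h \<beta> f (fst p) (snd p) {0..T} w" "t \<in> {0..T}" for w t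
      using that solutions_agree[OF sol[OF p]] unfolding ivp_solution_def by blast
    show "uniform_limit {0..T} (\<lambda>p t. fst (flow R p t)) (\<lambda>t. fst (flow R p t)) (at p within ball p0 r)"
      by (rule unif[OF lip_fst])
    show "uniform_limit {0..T} (\<lambda>p t. snd (flow R p t)) (\<lambda>t. snd (flow R p t)) (at p within ball p0 r)"
      by (rule unif[OF lip_snd])
    show "uniform_limit {0..T} (\<lambda>p t. rhs_linf h \<beta> f (fst (flow R p t)))
        (\<lambda>t. rhs_linf h \<beta> f (fst (flow R p t))) (at p within ball p0 r)"
      by (rule unif[OF lip_rhs[OF _ p]])
  qed
  then show "\<exists>r>0. \<exists>T>0. \<exists>V V' V''. \<forall>p\<in>ball p0 r.
      ivp_solution_derivs h \<beta> f (fst p) (snd p) {0..T} (V p) (V' p) (V'' p) \<and>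
      (\<forall>w. ivp_solution h \<beta> f (fst p) (snd p) {0..T} w \<longrightarrow> (\<forall>t\<in>{0..T}. w t = V p t)) \<and>
      uniform_limit {0..T} V (V p) (at p within ball p0 r) \<and>
      uniform_limit {0..T} V' (V' p) (at p within ball p0 r) \<and>
      uniform_limit {0..T} V'' (V'' p) (at p within ball p0 r)"
    using r T(1)
    by (intro exI[of _ r] conjI exI[of _ T] exI[of _ "\<lambda>p t. fst (flow R p t)"]
        exI[of _ "\<lambda>p t. snd (flow R p t)"] exI[of _ "\<lambda>p t. rhs_linf h \<beta> f (fst (flow R p t))"])
qed

section \<open>Continuation and the maximal solution\<close>

definition bounded_up_to :: "linf \<times> linf \<Rightarrow> real \<Rightarrow> real \<Rightarrow> bool" where
  "bounded_up_to p R t \<longleftrightarrow> 0 \<le> t \<and> (\<forall>s\<in>{0..t}. norm (fst (flow R p s)) \<le> R)"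

lemma bounded_up_to_antimono: "bounded_up_to p R t \<Longrightarrow> 0 \<le> s \<Longrightarrow> s \<le> t \<Longrightarrow> bounded_up_to p R s"
  by (simp add: bounded_up_to_def)

text \<open>Within the level \<open>R\<close> the truncation is not felt, so
  \<open>bounded_up_to p R t\<close> certifies existence up to time \<open>t\<close>.\<close>

lemma bounded_up_to_solution:
  assumes "bounded_up_to p R t"
  shows "ivp_solution_derivs h \<beta> f (fst p) (snd p) {0..t} (\<lambda>s. fst (flow R p s))
    (\<lambda>s. snd (flow R p s)) (\<lambda>s. rhs_linf h \<beta> f (fst (flow R p s)))"
  using assms by (intro flow_solution) (auto simp: bounded_up_to_def)

lemma flow_agree:
  assumes R: "bounded_up_to p R t" and Q: "bounded_up_to p Q t" and s: "s \<in> {0..t}"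
  shows "flow R p s = flow Q p s"
  using solutions_agree[OF bounded_up_to_solution[OF Q] bounded_up_to_solution[OF R] s] by simp

text \<open>A converse to \<open>bounded_up_to_solution\<close>: a solution with this bound is
  itself the truncated flow.\<close>

lemma solution_bounded_up_to:
  assumes sol: "ivp_solution_derivs h \<beta> f (fst p) (snd p) {0..t} v v' v''" and "0 \<le> t"
    and bound: "\<And>s. s \<in> {0..t} \<Longrightarrow> norm (v s) \<le> R"
  shows "bounded_up_to p R t"
  unfolding bounded_up_to_def
proof (intro conjI ballI)
  fix s assume "s \<in> {0..t}"
  then have "(v s, v' s) = flow R p s"
    using solution_eq_flow[OF sol bound] by simp
  then show "norm (fst (flow R p s)) \<le> R" using bound[OF \<open>s \<in> {0..t}\<close>] by (metis fst_conv)
qed fact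

text \<open>More than monotonicity of a bound, since \<open>R\<close> and \<open>Q\<close> refer to
  different flows: the flow at level \<open>R\<close> solves the original problem within the level
  \<open>Q\<close> and therefore equals the flow at level \<open>Q\<close>.\<close>

lemma bounded_up_to_mono:
  assumes "bounded_up_to p R t" "R \<le> Q"
  shows "bounded_up_to p Q t"
  using assms by (intro solution_bounded_up_to[OF bounded_up_to_solution[OF assms(1)]])
    (auto simp: bounded_up_to_def intro: order_trans)

text \<open>The flow at level \<open>R + 1\<close> is still within \<open>R\<close> up to time
  \<open>t\<close>, and by continuity it needs some time to use up the extra unit.\<close>

lemma bounded_up_to_extend:
  assumes t: "bounded_up_to p R t"
  obtains d where "d > 0" "bounded_up_to p (R + 1) (t + d)"
proof -
  have t1: "bounded_up_to p (R + 1) t" using t by (rule bounded_up_to_mono) simp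
  have "0 \<le> t" using t by (simp add: bounded_up_to_def)
  have le: "norm (fst (flow (R + 1) p s)) \<le> R" if "s \<in> {0..t}" for s
    using flow_agree[OF t1 t that] t that by (simp add: bounded_up_to_def)
  have "continuous_on {0..} (\<lambda>s. fst (flow (R + 1) p s))"
    by (intro continuous_intros continuous_on_flow) simp
  then obtain d where d: "d > 0"
    "\<And>s. 0 \<le> s \<Longrightarrow> dist s t < d \<Longrightarrow> dist (fst (flow (R + 1) p s)) (fst (flow (R + 1) p t)) < 1"
    using \<open>0 \<le> t\<close> zero_less_one unfolding continuous_on_iff by (metis atLeast_iff)
  have "norm (fst (flow (R + 1) p s)) \<le> R + 1" if s: "s \<in> {0..t + d / 2}" for s
  proof (cases "s \<le> t")
    case True
    then show ?thesis using le[of s] s by simp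
  next
    case False
    then have "dist (fst (flow (R + 1) p s)) (fst (flow (R + 1) p t)) < 1"
      using d s by (intro d) (auto simp: dist_real_def)
    then show ?thesis
      using le[of t] \<open>0 \<le> t\<close> norm_triangle_sub[of "fst (flow (R + 1) p s)" "fst (flow (R + 1) p t)"]
      by (simp add: dist_norm)
  qed
  then have "bounded_up_to p (R + 1) (t + d / 2)" using \<open>0 \<le> t\<close> d by (simp add: bounded_up_to_def)
  then show thesis using d by (intro that[of "d / 2"]) auto
qed

lemma maximal_solution:
  fixes \<phi> \<psi> :: linf
  shows "\<exists>T :: ereal. \<exists>v :: real \<Rightarrow> linf.
       T > 0 \<and>
       ivp_solution h \<beta> f \<phi> \<psi> (time_interval T) v \<and>
       (\<forall>S w. S > 0 \<and> ivp_solution h \<beta> f \<phi> \<psi> (time_interval S) w \<longrightarrow>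
          S \<le> T \<and> (\<forall>t\<in>time_interval S. w t = v t)) \<and>
       (\<forall>\<tau> :: real. 0 < \<tau> \<and> ereal \<tau> \<le> T \<longrightarrow>
          (T = ereal \<tau> \<longleftrightarrow> Limsup (at_left \<tau>) (\<lambda>t. ereal (norm (v t))) = \<infinity>))"
proof -
  define p where "p = (\<phi>, \<psi>)"
  \<comment> \<open>\<open>J\<close> is the life span, over all levels. At each time
    \<open>rad\<close> chooses an admissible level; by \<open>flow_agree\<close> the glued curve
    \<open>u\<close> does not depend on that choice.\<close>
  define J where "J = {t. \<exists>R. bounded_up_to p R t}"
  define T :: ereal where "T = (SUP t\<in>J. ereal t)"
  define rad where "rad t = (SOME R. bounded_up_to p R t)" for t
  define u where "u t = flow (rad t) p t" for t
  define v where "v t = fst (u t)" for t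
  have rad: "bounded_up_to p (rad t) t" if "t \<in> J" for t
    using that unfolding J_def rad_def by (auto intro: someI_ex)
  have J0: "0 \<in> J"
    unfolding J_def bounded_up_to_def by (auto intro!: exI[of _ "norm (fst p)"] simp: flow_0)
  have J_nonneg: "0 \<le> t" if "t \<in> J" for t using that by (auto simp: J_def bounded_up_to_def)
  have J_down: "s \<in> J" if "t \<in> J" "0 \<le> s" "s \<le> t" for s t
    using that bounded_up_to_antimono unfolding J_def by blast
  have J_open: "\<exists>d>0. t + d \<in> J" if "t \<in> J" for t
    using bounded_up_to_extend[OF rad[OF that]] unfolding J_def by (metis mem_Collect_eq)
  \<comment> \<open>\<open>J\<close> contains all earlier nonnegative times and, by
    \<open>J_open\<close>, has no largest element; so its supremum is not attained.\<close>
  have J: "time_interval T = J"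
  proof
    show "J \<subseteq> time_interval T"
    proof
      fix t assume t: "t \<in> J"
      then obtain d where "d > 0" "t + d \<in> J" using J_open by blast
      then have "ereal t < ereal (t + d)" "ereal (t + d) \<le> T"
        unfolding T_def by (auto intro: SUP_upper)
      then have "ereal t < T" by (rule less_le_trans)
      then show "t \<in> time_interval T"
        using J_nonneg[OF t] by (simp add: time_interval_def)
    qed
    show "time_interval T \<subseteq> J"
    proof
      fix t assume "t \<in> time_interval T"
      then have "0 \<le> t" "ereal t < T" by (auto simp: time_interval_def)
      then obtain s where "s \<in> J" "t < s" unfolding T_def less_SUP_iff by auto
      then show "t \<in> J" using J_down \<open>0 \<le> t\<close> by auto
    qed
  qed
  have T_pos: "T > 0"
    using J0 unfolding J[symmetric] by (simp add: time_interval_def zero_ereal_def)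
  have u_eq: "u s = flow R p s" if "bounded_up_to p R t" "s \<in> {0..t}" for R s t
  proof -
    have s: "bounded_up_to p R s" using that by (auto intro: bounded_up_to_antimono)
    then have "s \<in> J" by (auto simp: J_def)
    then show ?thesis unfolding u_def using that by (intro flow_agree[OF rad s]) auto
  qed
  \<comment> \<open>The level \<open>rad t\<close> varies with \<open>t\<close>. Near a fixed
    \<open>t\<close>, however, \<open>u\<close> coincides with the single flow at level
    \<open>rad t + 1\<close>, which stays admissible up to some time beyond
    \<open>t\<close>.\<close>
  have u_deriv: "(u has_vector_derivative field f (u t)) (at t within J)" if t: "t \<in> J" for t
  proof -
    obtain d where d: "d > 0" "bounded_up_to p (rad t + 1) (t + d)"
      using bounded_up_to_extend[OF rad[OF t]] by blast
    let ?x = "flow (rad t + 1) p"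
    have eq: "?x s = u s" if "s \<in> J" "dist s t < d" for s
      using u_eq[OF d(2), of s] J_nonneg[OF that(1)] that(2) by (auto simp: dist_real_def)
    have "norm (fst (?x t)) \<le> rad t + 1"
      using d J_nonneg[OF t] by (auto simp: bounded_up_to_def)
    then have "(?x has_vector_derivative field f (?x t)) (at t within {0..})"
      using flow_has_derivative[OF J_nonneg[OF t], of "rad t + 1" p] by (simp add: field_truncate)
    then have "(?x has_vector_derivative field f (?x t)) (at t within J)"
      by (rule has_vector_derivative_within_subset) (use J_nonneg in auto)
    then have "(u has_vector_derivative field f (?x t)) (at t within J)"
      using d(1) t eq by (rule has_vector_derivative_transform_within)
    then show ?thesis using eq[OF t] d(1) by simp
  qed
  have sol: "ivp_solution_derivs h \<beta> f \<phi> \<psi> J v (\<lambda>t. snd (u t)) (\<lambda>t. rhs_linf h \<beta> f (v t))"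
  proof -
    have "u 0 = (\<phi>, \<psi>)" by (simp add: u_def flow_0 p_def)
    then show ?thesis unfolding ivp_solution_derivs_iff v_def using u_deriv by simp
  qed
  \<comment> \<open>Any solution on \<open>[0, t]\<close> with a bound \<open>R\<close> places
    \<open>t\<close> in \<open>J\<close> and agrees there with \<open>v\<close>; this serves both
    for maximality and for the blow-up criterion.\<close>
  have in_J: "bounded_up_to p R t \<and> t \<in> J \<and> w t = v t"
    if w: "ivp_solution_derivs h \<beta> f \<phi> \<psi> {0..t} w w' w''" and "0 \<le> t"
      and bound: "\<And>s. s \<in> {0..t} \<Longrightarrow> norm (w s) \<le> R" for w w' w'' t R
  proof -
    have R: "bounded_up_to p R t"
      using w \<open>0 \<le> t\<close> bound by (intro solution_bounded_up_to) (auto simp: p_def)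
    moreover have "(w t, w' t) = flow R p t"
      unfolding p_def using w bound \<open>0 \<le> t\<close> by (intro solution_eq_flow) auto
    ultimately show ?thesis
      using u_eq[OF R, of t] \<open>0 \<le> t\<close> by (auto simp: J_def v_def) (metis fst_conv)
  qed
  have maximal: "S \<le> T \<and> (\<forall>t\<in>time_interval S. w t = v t)"
    if "S > 0" and w: "ivp_solution h \<beta> f \<phi> \<psi> (time_interval S) w" for S w
  proof -
    obtain w' w'' where w': "ivp_solution_derivs h \<beta> f \<phi> \<psi> (time_interval S) w w' w''"
      using w unfolding ivp_solution_def by blast
    have *: "t \<in> J \<and> w t = v t" if t: "t \<in> time_interval S" for t
    proof -
      have "{0..t} \<subseteq> time_interval S"
        using t by (auto simp: time_interval_def) (metis ereal_less_eq(3) le_less_trans)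
      then have wt: "ivp_solution_derivs h \<beta> f \<phi> \<psi> {0..t} w w' w''"
        by (rule ivp_solution_derivs_subset[OF w'])
      moreover obtain R where "\<And>s. s \<in> {0..t} \<Longrightarrow> norm (w s) \<le> R"
        using solution_bounded[OF wt] by blast
      ultimately show ?thesis using t in_J[of t w w' w'' R] by (simp add: time_interval_def)
    qed
    have "S \<le> T"
    proof (rule ccontr)
      assume "\<not> S \<le> T"
      then have "T < S" by simp
      \<comment> \<open>A real time strictly between \<open>T\<close> and \<open>S\<close> would
        belong to the life span of \<open>w\<close>, hence to \<open>J\<close>, and thus lie below
        \<open>T\<close>.\<close>
      then obtain z where z: "T < ereal z" "ereal z < S" using ereal_dense2 by blast
      have "0 < ereal z" using T_pos z(1) by (rule less_trans)
      then have "0 \<le> z" by simp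
      then have "z \<in> time_interval S" using z by (simp add: time_interval_def)
      then have "z \<in> time_interval T" using * J by blast
      then have "ereal z < T" by (simp add: time_interval_def)
      then show False using z(1) by (meson less_asym)
    qed
    then show ?thesis using * by blast
  qed
  have blowup: "T = ereal \<tau> \<longleftrightarrow> Limsup (at_left \<tau>) (\<lambda>t. ereal (norm (v t))) = \<infinity>"
    if "0 < \<tau>" "ereal \<tau> \<le> T" for \<tau>
  proof
    assume T: "T = ereal \<tau>"
    show "Limsup (at_left \<tau>) (\<lambda>t. ereal (norm (v t))) = \<infinity>"
    proof (rule ccontr)
      assume "Limsup (at_left \<tau>) (\<lambda>t. ereal (norm (v t))) \<noteq> \<infinity>"
      then obtain C where "Limsup (at_left \<tau>) (\<lambda>t. ereal (norm (v t))) < ereal C"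
        unfolding less_PInf_Ex_of_nat by blast
      then have "eventually (\<lambda>t. ereal (norm (v t)) < ereal C) (at_left \<tau>)" by (rule Limsup_lessD)
      then obtain b where b: "b < \<tau>" "\<And>t. b < t \<Longrightarrow> t < \<tau> \<Longrightarrow> norm (v t) < C"
        unfolding eventually_at_left_field by auto
      obtain s\<^sub>0 where s0: "max b 0 < s\<^sub>0" "s\<^sub>0 < \<tau>" using dense[of "max b 0" \<tau>] b \<open>0 < \<tau>\<close> by auto
      then have s0J: "s\<^sub>0 \<in> J" unfolding J[symmetric] by (simp add: time_interval_def T)
      \<comment> \<open>\<open>rad\<close> at \<open>s\<^sub>0\<close> bounds \<open>v\<close> up to
        \<open>s\<^sub>0\<close>, and \<open>C\<close> bounds it from there to
        \<open>\<tau>\<close>.\<close>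
      define R where "R = max (rad s\<^sub>0) C"
      have v_le: "norm (v s) \<le> R" if "0 \<le> s" "s < \<tau>" for s
      proof (cases "s \<le> s\<^sub>0")
        case True
        then have "norm (v s) \<le> rad s\<^sub>0"
          using u_eq[OF rad[OF s0J], of s] rad[OF s0J] that by (simp add: v_def bounded_up_to_def)
        then show ?thesis by (simp add: R_def)
      next
        case False
        then have "norm (v s) < C" using b s0 that by auto
        then show ?thesis by (simp add: R_def)
      qed
      have flow_le: "norm (fst (flow R p s)) \<le> R" if s: "0 \<le> s" "s < \<tau>" for s
      proof -
        have "{0..s} \<subseteq> J" unfolding J[symmetric] using s by (auto simp: time_interval_def T)
        then have "bounded_up_to p R s"
          using in_J[OF ivp_solution_derivs_subset[OF sol]] v_le s by auto
        then show ?thesis using s by (simp add: bounded_up_to_def)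
      qed
      \<comment> \<open>The truncated flow continues through \<open>\<tau>\<close>, so the bound
        passes to the closed interval by continuity. This puts \<open>\<tau>\<close> into
        \<open>J\<close>, against \<open>T = \<tau>\<close>.\<close>
      have "closure {0..<\<tau>} = {0..\<tau>}" using \<open>0 < \<tau>\<close> by simp
      moreover have "continuous_on {0..\<tau>} (\<lambda>s. fst (flow R p s))"
        by (intro continuous_intros continuous_on_flow) simp
      ultimately have "norm (fst (flow R p s)) \<le> R" if "s \<in> {0..\<tau>}" for s
        using continuous_on_closure_norm_le[of "{0..<\<tau>}" "\<lambda>s. fst (flow R p s)" R s] flow_le that
        by auto
      then have "bounded_up_to p R \<tau>" using \<open>0 < \<tau>\<close> by (simp add: bounded_up_to_def)
      then have "\<tau> \<in> J" unfolding J_def by blast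
      then show False unfolding J[symmetric] by (simp add: time_interval_def T)
    qed
  next
    assume limsup: "Limsup (at_left \<tau>) (\<lambda>t. ereal (norm (v t))) = \<infinity>"
    show "T = ereal \<tau>"
    proof (rule ccontr)
      assume "T \<noteq> ereal \<tau>"
      then have "ereal \<tau> < T" using \<open>ereal \<tau> \<le> T\<close> by simp
      then have \<tau>: "\<tau> \<in> J" unfolding J[symmetric] using \<open>0 < \<tau>\<close> by (simp add: time_interval_def)
      \<comment> \<open>If the life span reached beyond \<open>\<tau>\<close>, the level at
        \<open>\<tau>\<close> would bound \<open>v\<close> at all earlier times, and the limes
        superior would be finite.\<close>
      have "norm (v s) \<le> rad \<tau>" if "0 < s" "s < \<tau>" for s
        using u_eq[OF rad[OF \<tau>], of s] rad[OF \<tau>] that by (simp add: v_def bounded_up_to_def)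
      then have "eventually (\<lambda>s. ereal (norm (v s)) \<le> ereal (rad \<tau>)) (at_left \<tau>)"
        unfolding eventually_at_left_field using \<open>0 < \<tau>\<close> by auto
      then have "Limsup (at_left \<tau>) (\<lambda>t. ereal (norm (v t))) \<le> ereal (rad \<tau>)" by (rule Limsup_bounded)
      then show False using limsup by simp
    qed
  qed
  show ?thesis
  proof (intro exI[of _ T] exI[of _ v] conjI allI impI)
    show "ivp_solution h \<beta> f \<phi> \<psi> (time_interval T) v"
      using sol J unfolding ivp_solution_def by blast
  qed (use T_pos maximal blowup in blast)+
qed

end

theorem theorem3p5:
  fixes \<beta> f :: "real \<Rightarrow> real" and h :: real
  assumes kernel: "admissible_kernel \<beta>"
    and h_pos: "h > 0"
    and lipschitz: "locally_lipschitz f"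
    and f_zero: "f 0 = 0"
  shows "locally_well_posed h \<beta> f \<and>
    (\<forall>\<phi> \<psi> :: linf. \<exists>T :: ereal. \<exists>v :: real \<Rightarrow> linf.
       T > 0 \<and>
       ivp_solution h \<beta> f \<phi> \<psi> (time_interval T) v \<and>
       (\<forall>S w. S > 0 \<and> ivp_solution h \<beta> f \<phi> \<psi> (time_interval S) w \<longrightarrow>
          S \<le> T \<and> (\<forall>t\<in>time_interval S. w t = v t)) \<and>
       (\<forall>\<tau> :: real. 0 < \<tau> \<and> ereal \<tau> \<le> T \<longrightarrow>
          (T = ereal \<tau> \<longleftrightarrow> Limsup (at_left \<tau>) (\<lambda>t. ereal (norm (v t))) = \<infinity>)))"
proof -
  have "(\<lambda>i. norm (grid_restriction h \<beta> i)) summable_on UNIV"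
    using kernel h_pos unfolding admissible_kernel_def by (intro sobolev_W11_grid_summable) auto
  then interpret semidiscrete_ivp h \<beta> f
    using h_pos lipschitz by unfold_locales
  show ?thesis using well_posed maximal_solution by blast
qed

end
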